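(* With $\Gamma$, $H$, $D$, $\Lambda$, $M$, $N$, $R$ as described in the context, the canonical homomorphism $$\Gamma\rightarrow H\times_\Lambda D:=\{(\sigma,\tau)\in H\times D \mid \sigma|_R=\tau|_R\},\qquad \gamma\mapsto(\gamma|_M,\gamma|_N),$$ is an isomorphism.
   Context: All fields have characteristic zero. $\Pi=\{\partial_1,\dots,\partial_m\}$ is a finite set of commuting derivations, $F$ is a $\Pi$-closed field (every system of polynomial $\Pi$-differential equations over $F$ with a solution in some $\Pi$-field extension of $F$ has a solution in $F$), $\Delta=\{\delta_x\}\cup\Pi$, and $K=F(x)$ is the $\Delta$-field with $K^{\delta_x}=F$, $\delta_xx=1$, $\partial_jx=0$ for all $j$. A superscript of derivations denotes the subring of constants. For a $\Delta$-field extension $M_1/M_0$ and elements $y_i\in M_1$, $M_0\langle y_1,\dots,y_n\rangle_\Delta$ is the $\Delta$-subfield generated over $M_0$ by all derivatives of the $y_i$. A PPV-extension of $M_0$ for an order-$n$ homogeneous linear $\delta_x$-equation over $M_0$ is a $\Delta$-field extension $M_1\supseteq M_0$ generated as $M_1=M_0\langle y_1,\dots,y_n\rangle_\Delta$ by $n$ solutions linearly independent over $M_0^{\delta_x}$, with $M_1^{\delta_x}=M_0^{\delta_x}$. Its PPV-group $\mathrm{Gal}_\Delta(M_1/M_0)$ is the group of $\Delta$-automorphisms of $M_1$ over $M_0$. Let $r_1,r_0\in K$ and $q:=r_1^2-\delta_xr_1-r_0$. $M$ is a PPV-extension of $K$ for $\delta_x^2Y-qY=0$, with PPV-group $H=\mathrm{Gal}_\Delta(M/K)$;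 $\{\eta,\xi\}$ is an $F$-basis of its solution space in $M$; $U$ is a PPV-extension of $M$ for $\delta_xY-r_1Y=0$, and $0\ne\zeta\in U$ satisfies $\delta_x\zeta=r_1\zeta$. $N:=K\langle\zeta\rangle_\Delta\subseteq U$ is a PPV-extension of $K$ for $\delta_xY-r_1Y=0$, with PPV-group $D=\mathrm{Gal}_\Delta(N/K)$. $R:=M\cap N\subseteq U$ is a PPV-extension of $K$ (for some linear $\delta_x$-equation), with PPV-group $\Lambda:=\mathrm{Gal}_\Delta(R/K)$. The field $U=K\langle\zeta\eta,\zeta\xi,\zeta\rangle_\Delta$ is a PPV-extension of $K$, and $\Gamma:=\mathrm{Gal}_\Delta(U/K)$. *)

theory Defs
  imports
    "HOL-Algebra.Bij"
    "HOL-Algebra.QuotRing"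
    "HOL-Computational_Algebra.Polynomial"
    "HOL.Hull"
begin

section \<open>Differential fields\<close>

text \<open>
  A differential field is a HOL-Algebra field \<open>R\<close> together with a family \<open>d\<close> of maps, of which the
  members with index in \<open>I\<close> are commuting derivations of \<open>R\<close>.
\<close>

definition derivation_on :: "'a ring \<Rightarrow> ('a \<Rightarrow> 'a) \<Rightarrow> bool" where
  "derivation_on R \<delta> \<longleftrightarrow>
     \<delta> \<in> carrier R \<rightarrow> carrier R \<and>
     (\<forall>a\<in>carrier R. \<forall>b\<in>carrier R.
        \<delta> (a \<oplus>\<^bsub>R\<^esub> b) = \<delta> a \<oplus>\<^bsub>R\<^esub> \<delta> b \<and>
        \<delta> (a \<otimes>\<^bsub>R\<^esub> b) = (\<delta> a \<otimes>\<^bsub>R\<^esub> b) \<oplus>\<^bsub>R\<^esub> (a \<otimes>\<^bsub>R\<^esub> \<delta> b))"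

definition diff_field :: "'i set \<Rightarrow> 'a ring \<Rightarrow> ('i \<Rightarrow> 'a \<Rightarrow> 'a) \<Rightarrow> bool" where
  "diff_field I R d \<longleftrightarrow>
     field R \<and>
     (\<forall>i\<in>I. derivation_on R (d i)) \<and>
     (\<forall>i\<in>I. \<forall>j\<in>I. \<forall>a\<in>carrier R. d i (d j a) = d j (d i a))"

definition ring_on :: "'a::field set \<Rightarrow> 'a ring" where
  "ring_on S = \<lparr>carrier = S, monoid.mult = (*), one = 1, zero = 0, add = (+)\<rparr>"

lemma ring_on_simps [simp]:
  "carrier (ring_on S) = S" "\<zero>\<^bsub>ring_on S\<^esub> = 0" "\<one>\<^bsub>ring_on S\<^esub> = 1"
  "a \<oplus>\<^bsub>ring_on S\<^esub> b = a + b" "a \<otimes>\<^bsub>ring_on S\<^esub> b = a * b"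
  by (simp_all add: ring_on_def)

abbreviation diff_subfield :: "'i set \<Rightarrow> ('i \<Rightarrow> 'a::field \<Rightarrow> 'a) \<Rightarrow> 'a set \<Rightarrow> bool" where
  "diff_subfield I d S \<equiv> diff_field I (ring_on S) d"

definition field_gen :: "'a::field set \<Rightarrow> 'a set" where
  "field_gen A = (\<lambda>S. field (ring_on S)) hull A"

definition diff_gen :: "'i set \<Rightarrow> ('i \<Rightarrow> 'a::field \<Rightarrow> 'a) \<Rightarrow> 'a set \<Rightarrow> 'a set" where
  "diff_gen I d A = diff_subfield I d hull A"

definition constants :: "('a::zero \<Rightarrow> 'a) \<Rightarrow> 'a set \<Rightarrow> 'a set" where
  "constants \<delta> S = {a \<in> S. \<delta> a = 0}"


section \<open>Differentially closed fields\<close>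

text \<open>
  Differential polynomials in the unknowns numbered below \<open>n\<close> are represented by terms; every
  differential polynomial is denoted by some term, and only values of terms matter.
\<close>

datatype ('i, 'a) dterm =
    Coeff 'a
  | Unknown nat
  | Deriv 'i "('i, 'a) dterm"
  | Plus "('i, 'a) dterm" "('i, 'a) dterm"
  | Times "('i, 'a) dterm" "('i, 'a) dterm"

inductive_set diff_polys :: "'i set \<Rightarrow> 'a set \<Rightarrow> nat \<Rightarrow> ('i, 'a) dterm set"
  for I :: "'i set" and A :: "'a set" and n :: nat
where
  "a \<in> A \<Longrightarrow> Coeff a \<in> diff_polys I A n"
| "k < n \<Longrightarrow> Unknown k \<in> diff_polys I A n"
| "i \<in> I \<Longrightarrow> P \<in> diff_polys I A n \<Longrightarrow> Deriv i P \<in> diff_polys I A n"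
| "P \<in> diff_polys I A n \<Longrightarrow> Q \<in> diff_polys I A n \<Longrightarrow> Plus P Q \<in> diff_polys I A n"
| "P \<in> diff_polys I A n \<Longrightarrow> Q \<in> diff_polys I A n \<Longrightarrow> Times P Q \<in> diff_polys I A n"

primrec dterm_value ::
  "'b ring \<Rightarrow> ('i \<Rightarrow> 'b \<Rightarrow> 'b) \<Rightarrow> ('a \<Rightarrow> 'b) \<Rightarrow> (nat \<Rightarrow> 'b) \<Rightarrow> ('i, 'a) dterm \<Rightarrow> 'b" where
  "dterm_value R d \<phi> v (Coeff a) = \<phi> a"
| "dterm_value R d \<phi> v (Unknown k) = v k"
| "dterm_value R d \<phi> v (Deriv i P) = d i (dterm_value R d \<phi> v P)"
| "dterm_value R d \<phi> v (Plus P Q) = dterm_value R d \<phi> v P \<oplus>\<^bsub>R\<^esub> dterm_value R d \<phi> v Q"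
| "dterm_value R d \<phi> v (Times P Q) = dterm_value R d \<phi> v P \<otimes>\<^bsub>R\<^esub> dterm_value R d \<phi> v Q"

definition solvable_in ::
  "'b ring \<Rightarrow> ('i \<Rightarrow> 'b \<Rightarrow> 'b) \<Rightarrow> ('a \<Rightarrow> 'b) \<Rightarrow> nat \<Rightarrow> ('i, 'a) dterm set \<Rightarrow> bool" where
  "solvable_in R d \<phi> n \<S> \<longleftrightarrow>
     (\<exists>v. (\<forall>k<n. v k \<in> carrier R) \<and> (\<forall>P\<in>\<S>. dterm_value R d \<phi> v P = \<zero>\<^bsub>R\<^esub>))"

text \<open>
  An extension of \<open>R\<close> is given by a differential field \<open>L\<close> and an embedding \<open>\<phi>\<close>, and \<open>L\<close> ranges over
  all structures whose carrier consists of elements of the type \<open>'a\<close>.  For infinite \<open>R\<close> (in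
  particular in characteristic zero) this covers all extensions: the differential subfield
  generated over \<open>R\<close> by a solution in finitely many unknowns has the cardinality of \<open>R\<close>, hence an
  isomorphic copy with carrier in \<open>'a\<close>.
\<close>

definition diff_closed :: "'i set \<Rightarrow> 'a ring \<Rightarrow> ('i \<Rightarrow> 'a \<Rightarrow> 'a) \<Rightarrow> bool" where
  "diff_closed I R d \<longleftrightarrow>
     diff_field I R d \<and>
     (\<forall>(L :: 'a ring) e \<phi>.
        diff_field I L e \<and> \<phi> \<in> ring_hom R L \<and> (\<forall>i\<in>I. \<forall>a\<in>carrier R. \<phi> (d i a) = e i (\<phi> a)) \<longrightarrow>
        (\<forall>n. \<forall>\<S> \<subseteq> diff_polys I (carrier R) n.
           solvable_in L e \<phi> n \<S> \<longrightarrow> solvable_in R d id n \<S>))"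


section \<open>Parameterized Picard-Vessiot extensions\<close>

text \<open>
  The derivations \<open>d i\<close> are indexed by \<open>i \<in> {0..m}\<close>; \<open>d 0\<close> is the principal derivation
  \<open>\<delta>\<^sub>x\<close> and \<open>d 1, \<dots>, d m\<close> are the parametric derivations.

  A polynomial \<open>p\<close> serves as the list of coefficients of the linear differential operator
  \<open>\<Sum>i. coeff p i \<cdot> \<delta>\<^sup>i\<close>; its degree is the order of the operator.
\<close>

definition lin_op :: "('a::field \<Rightarrow> 'a) \<Rightarrow> 'a poly \<Rightarrow> 'a \<Rightarrow> 'a" where
  "lin_op \<delta> p y = (\<Sum>i\<le>degree p. coeff p i * (\<delta> ^^ i) y)"

definition lin_indep :: "'a::field set \<Rightarrow> 'a list \<Rightarrow> bool" where
  "lin_indep C ys \<longleftrightarrow>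
     (\<forall>c. (\<forall>i<length ys. c i \<in> C) \<and> (\<Sum>i<length ys. c i * ys ! i) = 0 \<longrightarrow>
        (\<forall>i<length ys. c i = 0))"

definition solutions :: "('a::field \<Rightarrow> 'a) \<Rightarrow> 'a poly \<Rightarrow> 'a set \<Rightarrow> 'a set" where
  "solutions \<delta> p S = {y \<in> S. lin_op \<delta> p y = 0}"

definition is_PPV :: "nat \<Rightarrow> (nat \<Rightarrow> 'a::field \<Rightarrow> 'a) \<Rightarrow> 'a set \<Rightarrow> 'a set \<Rightarrow> 'a poly \<Rightarrow> bool" where
  "is_PPV m d M\<^sub>0 M\<^sub>1 p \<longleftrightarrow>
     diff_subfield {0..m} d M\<^sub>0 \<and> diff_subfield {0..m} d M\<^sub>1 \<and> M\<^sub>0 \<subseteq> M\<^sub>1 \<and>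
     p \<noteq> 0 \<and> set (coeffs p) \<subseteq> M\<^sub>0 \<and>
     (\<exists>ys. length ys = degree p \<and> set ys \<subseteq> solutions (d 0) p M\<^sub>1 \<and>
        lin_indep (constants (d 0) M\<^sub>0) ys \<and>
        M\<^sub>1 = diff_gen {0..m} d (M\<^sub>0 \<union> set ys)) \<and>
     constants (d 0) M\<^sub>1 = constants (d 0) M\<^sub>0"

text \<open>
  As in \<^const>\<open>BijGroup\<close>, automorphisms are functions that are undefined outside \<open>M\<^sub>1\<close>; restrictions
  of automorphisms to subfields are therefore taken with \<^const>\<open>restrict\<close>.
\<close>

definition diff_aut :: "'i set \<Rightarrow> ('i \<Rightarrow> 'a::field \<Rightarrow> 'a) \<Rightarrow> 'a set \<Rightarrow> 'a set \<Rightarrow> ('a \<Rightarrow> 'a) set" where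
  "diff_aut I d M\<^sub>1 M\<^sub>0 =
     {\<sigma> \<in> Bij M\<^sub>1. \<sigma> \<in> ring_iso (ring_on M\<^sub>1) (ring_on M\<^sub>1) \<and>
        (\<forall>i\<in>I. \<forall>a\<in>M\<^sub>1. \<sigma> (d i a) = d i (\<sigma> a)) \<and> (\<forall>a\<in>M\<^sub>0. \<sigma> a = a)}"

definition Gal :: "'i set \<Rightarrow> ('i \<Rightarrow> 'a::field \<Rightarrow> 'a) \<Rightarrow> 'a set \<Rightarrow> 'a set \<Rightarrow> ('a \<Rightarrow> 'a) monoid" where
  "Gal I d M\<^sub>1 M\<^sub>0 = BijGroup M\<^sub>1 \<lparr>carrier := diff_aut I d M\<^sub>1 M\<^sub>0\<rparr>"

definition fibre_product ::
  "('a \<Rightarrow> 'a) monoid \<Rightarrow> ('a \<Rightarrow> 'a) monoid \<Rightarrow> 'a set \<Rightarrow> (('a \<Rightarrow> 'a) \<times> ('a \<Rightarrow> 'a)) monoid" where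
  "fibre_product H D R =
     (H \<times>\<times> D) \<lparr>carrier := {(\<sigma>, \<tau>) \<in> carrier H \<times> carrier D. restrict \<sigma> R = restrict \<tau> R}\<rparr>"

lemma group_Gal:
  assumes "diff_subfield I d M\<^sub>1" and "M\<^sub>0 \<subseteq> M\<^sub>1"
  shows "group (Gal I d M\<^sub>1 M\<^sub>0)"
proof -
  have clos: "d i a \<in> M\<^sub>1" if "i \<in> I" "a \<in> M\<^sub>1" for i a
    using assms(1) that by (auto simp: diff_field_def derivation_on_def)
  interpret f: field "ring_on M\<^sub>1" using assms(1) by (simp add: diff_field_def)
  have c1: "1 \<in> M\<^sub>1" and ca: "\<And>a b. a \<in> M\<^sub>1 \<Longrightarrow> b \<in> M\<^sub>1 \<Longrightarrow> a + b \<in> M\<^sub>1 \<and> a * b \<in> M\<^sub>1"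
    using f.one_closed f.add.m_closed f.m_closed by auto
  have iff: "\<sigma> \<in> diff_aut I d M\<^sub>1 M\<^sub>0 \<longleftrightarrow> \<sigma> \<in> Bij M\<^sub>1 \<and> \<sigma> 1 = 1 \<and>
      (\<forall>a\<in>M\<^sub>1. \<forall>b\<in>M\<^sub>1. \<sigma> (a + b) = \<sigma> a + \<sigma> b \<and> \<sigma> (a * b) = \<sigma> a * \<sigma> b) \<and>
      (\<forall>i\<in>I. \<forall>a\<in>M\<^sub>1. \<sigma> (d i a) = d i (\<sigma> a)) \<and> (\<forall>a\<in>M\<^sub>0. \<sigma> a = a)" for \<sigma>
    unfolding diff_aut_def ring_iso_def ring_hom_def Bij_def
    by (auto dest: bij_betwE)
  have "subgroup (diff_aut I d M\<^sub>1 M\<^sub>0) (BijGroup M\<^sub>1)"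
  proof (rule group.subgroupI[OF group_BijGroup])
    show "diff_aut I d M\<^sub>1 M\<^sub>0 \<subseteq> carrier (BijGroup M\<^sub>1)"
      by (auto simp: diff_aut_def BijGroup_def)
    have "(\<lambda>x\<in>M\<^sub>1. x) \<in> diff_aut I d M\<^sub>1 M\<^sub>0"
      using c1 ca clos assms(2) by (auto simp: iff id_Bij)
    then show "diff_aut I d M\<^sub>1 M\<^sub>0 \<noteq> {}" by blast
  next
    fix \<sigma> assume s: "\<sigma> \<in> diff_aut I d M\<^sub>1 M\<^sub>0"
    then have B: "\<sigma> \<in> Bij M\<^sub>1" by (simp add: iff)
    let ?g = "inv_into M\<^sub>1 \<sigma>"
    have bij: "bij_betw \<sigma> M\<^sub>1 M\<^sub>1" using B by (simp add: Bij_def)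
    have g1: "?g y \<in> M\<^sub>1" if "y \<in> M\<^sub>1" for y using Bij_inv_into_mem[OF B that] .
    have g2: "\<sigma> (?g y) = y" if "y \<in> M\<^sub>1" for y
      using bij that by (simp add: bij_betw_inv_into_right)
    have g3: "?g z = y" if "y \<in> M\<^sub>1" "\<sigma> y = z" for y z
      using bij that by (auto simp: bij_betw_inv_into_left)
    have "(\<lambda>y\<in>M\<^sub>1. ?g y) \<in> diff_aut I d M\<^sub>1 M\<^sub>0"
      unfolding iff
      using s[unfolded iff] c1 ca clos assms(2) g1 g2
      by (auto simp: restrict_inv_into_Bij[OF B] intro!: g3)
    then show "inv\<^bsub>BijGroup M\<^sub>1\<^esub> \<sigma> \<in> diff_aut I d M\<^sub>1 M\<^sub>0"
      by (simp add: inv_BijGroup[OF B])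
  next
    fix \<sigma> \<tau> assume s: "\<sigma> \<in> diff_aut I d M\<^sub>1 M\<^sub>0" and t: "\<tau> \<in> diff_aut I d M\<^sub>1 M\<^sub>0"
    then have B: "\<sigma> \<in> Bij M\<^sub>1" "\<tau> \<in> Bij M\<^sub>1" by (simp_all add: iff)
    have tm: "\<tau> a \<in> M\<^sub>1" if "a \<in> M\<^sub>1" for a using Bij_imp_funcset[OF B(2)] that by auto
    have "compose M\<^sub>1 \<sigma> \<tau> \<in> diff_aut I d M\<^sub>1 M\<^sub>0"
      using s[unfolded iff] t[unfolded iff] c1 ca clos assms(2) tm
      by (auto simp: iff compose_Bij compose_def subset_iff) (auto simp: compose_def[symmetric] compose_Bij)
    then show "\<sigma> \<otimes>\<^bsub>BijGroup M\<^sub>1\<^esub> \<tau> \<in> diff_aut I d M\<^sub>1 M\<^sub>0"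
      by (simp add: BijGroup_def B)
  qed
  then show ?thesis
    unfolding Gal_def by (rule subgroup.subgroup_is_group[OF _ group_BijGroup])
qed

end

theory Submission
  imports Defs "HOL-Library.Multiset"
begin

text \<open>
  Write \<open>\<delta>\<close> for the principal derivation.  Injectivity of the restriction map holds because
  \<open>U\<close> is generated by \<open>M\<close> and \<open>N\<close>: \<open>U\<close> is generated over \<open>M\<close> by some solution of
  \<open>\<delta> y = r\<^sub>1 y\<close>, and this is a constant multiple of \<open>\<zeta>\<close>.  The map takes values in
  \<open>H \<times> D\<close> because automorphisms of \<open>U\<close> send solutions to solutions, and the solutions in
  \<open>U\<close> of the two equations are combinations, over constants lying in \<open>K\<close>, of those that generate
  \<open>M\<close> and \<open>N\<close>; here it matters that \<open>U\<close> has no more constants than \<open>K\<close>.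

  Surjectivity is the point.  Let \<open>(\<sigma>, \<tau>)\<close> agree on \<open>R = M \<inter> N\<close>.  They extend to \<open>U\<close> as soon as
  every relation \<open>\<Sum> m\<^sub>i n\<^sub>i = 0\<close> with \<open>m\<^sub>i \<in> M\<close> and \<open>n\<^sub>i \<in> N\<close> is equivalent to
  \<open>\<Sum> \<sigma> m\<^sub>i \<tau> n\<^sub>i = 0\<close>: then \<open>\<Sum> m\<^sub>i n\<^sub>i \<mapsto> \<Sum> \<sigma> m\<^sub>i \<tau> n\<^sub>i\<close> is a well defined injection,
  it passes to fractions, and these make up all of \<open>U\<close> (\<open>diff_aut_glue\<close>).  The
  equivalence is linear disjointness of \<open>M\<close> and \<open>N\<close> over \<open>R\<close> (\<open>linearly_disjoint\<close>), which is
  proved without Galois theory, by a form of the Kolchin-Ostrowski theorem.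

  Every logarithmic derivative \<open>d\<^sub>i \<zeta> / \<zeta>\<close> lies in
  \<open>Z = {z \<in> N. \<delta> z \<in> K}\<close>, since \<open>\<delta> (d\<^sub>i \<zeta> / \<zeta>) = d\<^sub>i r\<^sub>1\<close>, and \<open>Z\<close> is stable under all
  derivations.  Hence \<open>N\<close> is generated as a field by \<open>K\<close>, one exponential \<open>\<zeta>\<close> and the
  primitives in \<open>Z\<close>.  Choose \<open>B \<subseteq> Z\<close> maximal among the sets that are linearly independent over
  the constants modulo \<open>M\<close>.  An element of \<open>Z\<close> then differs from a constant combination of \<open>B\<close> by
  an element of \<open>M \<inter> N = R\<close>.  So \<open>N\<close> is the field of fractions of the \<open>R\<close>-span \<open>A\<close> of the
  monomials \<open>\<zeta>\<^sup>k b\<^sub>1 \<cdots> b\<^sub>s\<close>, where \<open>k\<close> is restricted to be smaller than the first positive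
  exponent, if there is one, whose power of \<open>\<zeta>\<close> lies in \<open>M\<close>.

  These monomials are linearly independent over \<open>M\<close> (\<open>monomials_independent\<close>), because
  differentiating a minimal relation yields a shorter one, which must be trivial; its coefficients
  then either exhibit a power of \<open>\<zeta>\<close> in \<open>M\<close> or a constant combination of \<open>B\<close> in \<open>M\<close>.
  Writing the \<open>n\<^sub>i\<close> over a common denominator in the monomials turns
  \<open>\<Sum> m\<^sub>i n\<^sub>i = 0\<close> into the vanishing of coefficients in \<open>M\<close>, which \<open>\<sigma>\<close> preserves.
  For the converse one needs the same independence for the images of the monomials under \<open>\<tau>\<close>;
  it holds because \<open>\<tau>\<close> multiplies \<open>\<zeta>\<close> by a constant and translates each \<open>b \<in> B\<close> by a
  constant (\<open>twisted_monomials_independent\<close>).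
\<close>

section \<open>Subfields and derivations\<close>

definition subring_set :: "'a::field set \<Rightarrow> bool" where
  "subring_set T \<longleftrightarrow> 0 \<in> T \<and> 1 \<in> T \<and> (\<forall>a\<in>T. - a \<in> T) \<and>
     (\<forall>a\<in>T. \<forall>b\<in>T. a + b \<in> T \<and> a * b \<in> T)"

lemma subring_setD:
  assumes "subring_set T"
  shows "0 \<in> T" "1 \<in> T" "a \<in> T \<Longrightarrow> - a \<in> T"
    "a \<in> T \<Longrightarrow> b \<in> T \<Longrightarrow> a + b \<in> T" "a \<in> T \<Longrightarrow> b \<in> T \<Longrightarrow> a * b \<in> T"
  using assms by (auto simp: subring_set_def)

lemma subring_set_closed:
  assumes "subring_set T"
  shows "a \<in> T \<Longrightarrow> b \<in> T \<Longrightarrow> a - b \<in> T" "a \<in> T \<Longrightarrow> a ^ k \<in> T" "of_nat n \<in> T"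
    "(\<And>i. i \<in> I \<Longrightarrow> f i \<in> T) \<Longrightarrow> sum f I \<in> T"
    "(\<And>b. b \<in># \<alpha> \<Longrightarrow> b \<in> T) \<Longrightarrow> \<Prod>\<^sub># \<alpha> \<in> T"
proof -
  note T = subring_setD[OF assms]
  show "a \<in> T \<Longrightarrow> b \<in> T \<Longrightarrow> a - b \<in> T"
    using T(4)[OF _ T(3), of a b] by simp
  show "a \<in> T \<Longrightarrow> a ^ k \<in> T" by (induction k) (auto intro: T)
  show "of_nat n \<in> T" by (induction n) (auto intro: T)
  show "(\<And>i. i \<in> I \<Longrightarrow> f i \<in> T) \<Longrightarrow> sum f I \<in> T"
    by (induction I rule: infinite_finite_induct) (auto intro: T)
  show "(\<And>b. b \<in># \<alpha> \<Longrightarrow> b \<in> T) \<Longrightarrow> \<Prod>\<^sub># \<alpha> \<in> T"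
    by (induction \<alpha>) (auto intro: T)
qed

text \<open>
  Makes it possible to verify closure conditions of subsets of the ambient field in place of ring
  axioms.
\<close>
lemma field_ring_on_iff:
  "field (ring_on S) \<longleftrightarrow> subring_set S \<and> (\<forall>a\<in>S. inverse a \<in> S)"
proof
  assume "field (ring_on S)"
  then interpret f: field "ring_on S" .
  have neg: "- a \<in> S" if "a \<in> S" for a
  proof -
    obtain b where "b \<in> S" "b + a = 0" using f.add.l_inv_ex[of a] \<open>a \<in> S\<close> by auto
    moreover from this have "b = - a" by (simp add: eq_neg_iff_add_eq_0)
    ultimately show ?thesis by simp
  qed
  have inv: "inverse a \<in> S" if "a \<in> S" for a
  proof (cases "a = 0")
    case False
    then have "a \<in> Units (ring_on S)" using f.field_Units that by simp
    then obtain b where "b \<in> S" "b * a = 1" by (auto simp: Units_def)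
    moreover from this have "inverse a = b" using False by (simp add: inverse_unique mult.commute)
    ultimately show ?thesis by simp
  qed (use that in simp)
  show "subring_set S \<and> (\<forall>a\<in>S. inverse a \<in> S)"
    using neg inv f.zero_closed f.one_closed f.add.m_closed f.m_closed
    by (auto simp: subring_set_def)
next
  assume S: "subring_set S \<and> (\<forall>a\<in>S. inverse a \<in> S)"
  note T = subring_setD[OF conjunct1[OF S]]
  have "cring (ring_on S)"
  proof (rule cringI)
    show "abelian_group (ring_on S)"
    proof (rule abelian_groupI)
      fix a assume "a \<in> carrier (ring_on S)"
      then show "\<exists>b\<in>carrier (ring_on S). b \<oplus>\<^bsub>ring_on S\<^esub> a = \<zero>\<^bsub>ring_on S\<^esub>"
        by (intro bexI[of _ "- a"]) (auto intro: T)
    qed (auto intro: T simp: algebra_simps)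
    show "comm_monoid (ring_on S)"
      by (rule comm_monoidI) (auto intro: T simp: algebra_simps)
  qed (auto simp: algebra_simps)
  then show "field (ring_on S)"
  proof (rule cring.cring_fieldI2)
    show "\<zero>\<^bsub>ring_on S\<^esub> \<noteq> \<one>\<^bsub>ring_on S\<^esub>" by simp
    fix a assume "a \<in> carrier (ring_on S)" "a \<noteq> \<zero>\<^bsub>ring_on S\<^esub>"
    then show "\<exists>b\<in>carrier (ring_on S). a \<otimes>\<^bsub>ring_on S\<^esub> b = \<one>\<^bsub>ring_on S\<^esub>"
      using S by (intro bexI[of _ "inverse a"]) auto
  qed
qed

lemma subfield_subring: "field (ring_on S) \<Longrightarrow> subring_set S"
  by (simp add: field_ring_on_iff)

lemma subfield_inverse: "field (ring_on S) \<Longrightarrow> a \<in> S \<Longrightarrow> inverse a \<in> S"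
  by (simp add: field_ring_on_iff)

lemma subfield_divide: "field (ring_on S) \<Longrightarrow> a \<in> S \<Longrightarrow> b \<in> S \<Longrightarrow> a / b \<in> S"
  by (simp add: field_ring_on_iff subring_setD divide_inverse)

definition fractions :: "'a::field set \<Rightarrow> 'a set" where
  "fractions T = {p / q |p q. p \<in> T \<and> q \<in> T \<and> q \<noteq> 0}"

lemma fractionsI: "p \<in> T \<Longrightarrow> q \<in> T \<Longrightarrow> q \<noteq> 0 \<Longrightarrow> p / q \<in> fractions T"
  by (auto simp: fractions_def)

lemma field_fractions:
  assumes "subring_set T"
  shows "field (ring_on (fractions T))"
proof -
  note T = subring_setD[OF assms]
  have emb: "a \<in> fractions T" if "a \<in> T" for a
    using fractionsI[OF that T(2)] by simp
  have 1: "- u \<in> fractions T \<and> inverse u \<in> fractions T" if u: "u \<in> fractions T" for u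
  proof -
    obtain p q where "p \<in> T" "q \<in> T" "q \<noteq> 0" "u = p / q" using u by (auto simp: fractions_def)
    then show ?thesis
      using fractionsI[of "- p" T q] fractionsI[of q T p] emb T by (cases "p = 0") auto
  qed
  have 2: "u + v \<in> fractions T \<and> u * v \<in> fractions T"
    if uv: "u \<in> fractions T" "v \<in> fractions T" for u v
  proof -
    obtain p q where u: "p \<in> T" "q \<in> T" "q \<noteq> 0" "u = p / q" using uv(1) by (auto simp: fractions_def)
    obtain p' q' where v: "p' \<in> T" "q' \<in> T" "q' \<noteq> 0" "v = p' / q'"
      using uv(2) by (auto simp: fractions_def)
    have "u + v = (p * q' + p' * q) / (q * q')" "u * v = (p * p') / (q * q')"
      using u v by (auto simp: field_simps)
    then show ?thesis using u v by (auto intro!: fractionsI T)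
  qed
  show ?thesis
    unfolding field_ring_on_iff subring_set_def using 1 2 emb T by blast
qed

text \<open>
  A derivation here satisfies the sum and product rules only on \<open>U\<close>, so every law carries
  membership conditions.
\<close>
locale field_derivation =
  fixes U :: "'a::field_char_0 set" and \<delta> :: "'a \<Rightarrow> 'a"
  assumes field_U: "field (ring_on U)" and deriv: "derivation_on (ring_on U) \<delta>"
begin

lemmas U_ring = subring_setD[OF subfield_subring[OF field_U]]
  subring_set_closed[OF subfield_subring[OF field_U]]
lemmas U_closed = U_ring subfield_inverse[OF field_U] subfield_divide[OF field_U]

lemma der_in: "a \<in> U \<Longrightarrow> \<delta> a \<in> U"
  using deriv by (auto simp: derivation_on_def)

lemma der_add: "a \<in> U \<Longrightarrow> b \<in> U \<Longrightarrow> \<delta> (a + b) = \<delta> a + \<delta> b"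
  using deriv by (auto simp: derivation_on_def)

lemma der_mult: "a \<in> U \<Longrightarrow> b \<in> U \<Longrightarrow> \<delta> (a * b) = \<delta> a * b + a * \<delta> b"
  using deriv by (auto simp: derivation_on_def)

lemma der_0: "\<delta> 0 = 0"
  using der_add[of 0 0] U_closed(1) by simp

lemma der_1: "\<delta> 1 = 0"
  using der_mult[of 1 1] U_closed(2) by simp

lemma der_uminus: "a \<in> U \<Longrightarrow> \<delta> (- a) = - \<delta> a"
  using der_add[of a "- a"] U_closed(3)[of a] der_0 by (simp add: eq_neg_iff_add_eq_0 add.commute)

lemma der_diff: "a \<in> U \<Longrightarrow> b \<in> U \<Longrightarrow> \<delta> (a - b) = \<delta> a - \<delta> b"
  using der_add[of a "- b"] U_closed(3)[of b] der_uminus[of b] by simp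

lemma der_divide:
  assumes "a \<in> U" "b \<in> U" "b \<noteq> 0"
  shows "\<delta> (a / b) = (\<delta> a * b - a * \<delta> b) / (b * b)"
proof -
  have "\<delta> a = \<delta> (a / b * b)" using assms by simp
  also have "\<dots> = \<delta> (a / b) * b + a / b * \<delta> b"
    using assms by (intro der_mult U_closed)
  finally show ?thesis using assms(3) by (simp add: field_simps)
qed

lemma der_sum: "(\<And>i. i \<in> I \<Longrightarrow> f i \<in> U) \<Longrightarrow> \<delta> (sum f I) = (\<Sum>i\<in>I. \<delta> (f i))"
proof (induction I rule: infinite_finite_induct)
  case (insert i I)
  then show ?case using U_closed(9)[of I f] by (simp add: der_add)
qed (auto simp: der_0)

lemma der_of_nat: "\<delta> (of_nat n) = 0"
  by (induction n) (auto simp: der_0 der_1 der_add U_closed)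

lemma der_power:
  assumes "\<zeta> \<in> U" "\<delta> \<zeta> = r * \<zeta>"
  shows "\<delta> (\<zeta> ^ k) = of_nat k * r * \<zeta> ^ k"
  using assms by (induction k) (auto simp: der_1 der_mult U_closed algebra_simps)

text \<open>
  The Leibniz rule in the form of partial derivatives, \<open>b\<close> running through the variables.  A
  variable missing from \<open>\<alpha>\<close> contributes nothing because its count is zero, although the truncated
  multiset difference is then \<open>\<alpha>\<close> itself.
\<close>
lemma der_prod_mset:
  assumes "finite B" "set_mset \<alpha> \<subseteq> B" "B \<subseteq> U"
  shows "\<delta> (\<Prod>\<^sub># \<alpha>) = (\<Sum>b\<in>B. of_nat (count \<alpha> b) * \<delta> b * \<Prod>\<^sub># (\<alpha> - {#b#}))"
  using assms(2)
proof (induction \<alpha>)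
  case (add a \<alpha>)
  have a: "a \<in> B" "set_mset \<alpha> \<subseteq> B" using add.prems by auto
  have *: "of_nat (count (add_mset a \<alpha>) b) * \<delta> b * \<Prod>\<^sub># (add_mset a \<alpha> - {#b#})
      = a * (of_nat (count \<alpha> b) * \<delta> b * \<Prod>\<^sub># (\<alpha> - {#b#})) + (if b = a then \<delta> a * \<Prod>\<^sub># \<alpha> else 0)"
    (is "?l = ?r") for b
  proof (cases "b \<in># \<alpha>")
    case True
    then obtain \<beta> where "\<alpha> = add_mset b \<beta>" by (metis insert_DiffM)
    then show ?thesis by (auto simp: algebra_simps)
  next
    case False
    then have "count \<alpha> b = 0" by (simp add: not_in_iff)
    then show ?thesis by (cases "b = a") auto
  qed
  have "\<delta> (\<Prod>\<^sub># (add_mset a \<alpha>)) = \<delta> a * \<Prod>\<^sub># \<alpha> + a * \<delta> (\<Prod>\<^sub># \<alpha>)"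
    using a assms(3) by (auto simp: der_mult U_closed subset_iff)
  also have "\<dots> = (\<Sum>b\<in>B. of_nat (count (add_mset a \<alpha>) b) * \<delta> b * \<Prod>\<^sub># (add_mset a \<alpha> - {#b#}))"
    unfolding * add.IH[OF a(2)] using a(1) assms(1) by (simp add: sum.distrib sum_distrib_left)
  finally show ?case .
qed (simp add: der_1)

end

section \<open>Differential subfields\<close>

lemma diff_subfieldD:
  assumes "diff_subfield I d S"
  shows "field (ring_on S)" "i \<in> I \<Longrightarrow> derivation_on (ring_on S) (d i)"
    "i \<in> I \<Longrightarrow> a \<in> S \<Longrightarrow> d i a \<in> S"
    "i \<in> I \<Longrightarrow> j \<in> I \<Longrightarrow> a \<in> S \<Longrightarrow> d i (d j a) = d j (d i a)"
  using assms by (auto simp: diff_field_def derivation_on_def)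

lemma diff_subfield_closed:
  assumes "diff_subfield I d L"
  shows "0 \<in> L" "1 \<in> L" "a \<in> L \<Longrightarrow> - a \<in> L" "a \<in> L \<Longrightarrow> b \<in> L \<Longrightarrow> a + b \<in> L"
    "a \<in> L \<Longrightarrow> b \<in> L \<Longrightarrow> a * b \<in> L" "a \<in> L \<Longrightarrow> inverse a \<in> L" "a \<in> L \<Longrightarrow> b \<in> L \<Longrightarrow> a / b \<in> L"
    "i \<in> I \<Longrightarrow> a \<in> L \<Longrightarrow> d i a \<in> L"
  using assms subring_setD[OF subfield_subring[OF diff_subfieldD(1)[OF assms]]]
    subfield_inverse[OF diff_subfieldD(1)[OF assms]] subfield_divide[OF diff_subfieldD(1)[OF assms]]
  by (auto dest: diff_subfieldD(3))

lemma diff_subfield_subset: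
  assumes "diff_subfield I d U" "S \<subseteq> U" "field (ring_on S)"
    "\<And>i a. i \<in> I \<Longrightarrow> a \<in> S \<Longrightarrow> d i a \<in> S"
  shows "diff_subfield I d S"
  using assms by (auto simp: diff_field_def derivation_on_def subset_iff)

lemma diff_subfield_Int:
  assumes "diff_subfield I d S" "diff_subfield I d T"
  shows "diff_subfield I d (S \<inter> T)"
  using assms by (intro diff_subfield_subset[OF assms(1)])
    (auto simp: field_ring_on_iff subring_set_def dest: diff_subfieldD)

lemma diff_gen_subset: "diff_subfield I d S \<Longrightarrow> A \<subseteq> S \<Longrightarrow> diff_gen I d A \<subseteq> S"
  unfolding diff_gen_def by (rule hull_minimal)

lemma diff_gen_superset: "A \<subseteq> diff_gen I d A"
  unfolding diff_gen_def by (rule hull_subset)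

lemma diff_subfield_diff_gen:
  assumes "diff_subfield I d U" "A \<subseteq> U"
  shows "diff_subfield I d (diff_gen I d A)"
proof (rule diff_subfield_subset[OF assms(1) diff_gen_subset[OF assms]])
  have mem: "a \<in> diff_gen I d A \<longleftrightarrow> (\<forall>T. diff_subfield I d T \<and> A \<subseteq> T \<longrightarrow> a \<in> T)" for a
    by (auto simp: diff_gen_def hull_def)
  show "field (ring_on (diff_gen I d A))"
  proof -
    have T: "subring_set T \<and> (\<forall>a\<in>T. inverse a \<in> T)" if "diff_subfield I d T" for T
      using diff_subfieldD(1)[OF that] by (simp add: field_ring_on_iff)
    show ?thesis
      unfolding field_ring_on_iff subring_set_def Ball_def mem
      using T unfolding subring_set_def by blast
  qed
  show "d i a \<in> diff_gen I d A" if "i \<in> I" "a \<in> diff_gen I d A" for i a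
    using that unfolding mem by (auto dest: diff_subfieldD(3))
qed

lemma field_derivation_diff_subfield:
  "diff_subfield I d (U :: 'a::field_char_0 set) \<Longrightarrow> i \<in> I \<Longrightarrow> field_derivation U (d i)"
  by (simp add: field_derivation_def diff_subfieldD)

lemma field_constants:
  assumes "diff_subfield I d (S :: 'a::field_char_0 set)" "i \<in> I"
  shows "field (ring_on (constants (d i) S))"
proof -
  interpret field_derivation S "d i" by (rule field_derivation_diff_subfield[OF assms])
  have "d i (inverse a) = 0" if "a \<in> S" "d i a = 0" for a
    using der_divide[of 1 a] that U_closed(2) by (cases "a = 0") (auto simp: der_0 der_1 divide_inverse)
  then show ?thesis
    unfolding field_ring_on_iff subring_set_def constants_def
    by (auto simp: der_0 der_1 der_add der_mult der_uminus intro: U_closed)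
qed

section \<open>Ring homomorphisms\<close>

lemma ring_hom_onD:
  assumes "\<sigma> \<in> ring_hom (ring_on M) (ring_on M')"
  shows "a \<in> M \<Longrightarrow> \<sigma> a \<in> M'" "\<sigma> 1 = 1"
    "a \<in> M \<Longrightarrow> b \<in> M \<Longrightarrow> \<sigma> (a + b) = \<sigma> a + \<sigma> b"
    "a \<in> M \<Longrightarrow> b \<in> M \<Longrightarrow> \<sigma> (a * b) = \<sigma> a * \<sigma> b"
  using assms by (auto simp: ring_hom_def)

lemma ring_hom_on_0:
  assumes "\<sigma> \<in> ring_hom (ring_on M) (ring_on M')" "subring_set M"
  shows "\<sigma> 0 = 0"
proof -
  have "\<sigma> 0 + \<sigma> 0 = \<sigma> 0 + 0"
    using ring_hom_onD(3)[OF assms(1), of 0 0] subring_setD(1)[OF assms(2)]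
    by (simp only: add_0_left add_0_right)
  then show ?thesis by (simp only: add_left_cancel)
qed

lemma ring_hom_on_uminus:
  assumes "\<sigma> \<in> ring_hom (ring_on M) (ring_on M')" "subring_set M" "a \<in> M"
  shows "\<sigma> (- a) = - \<sigma> a"
  using ring_hom_onD(3)[OF assms(1,3), of "- a"] subring_setD(3)[OF assms(2,3)] ring_hom_on_0[OF assms(1,2)]
  by (simp add: eq_neg_iff_add_eq_0 add.commute)

lemma ring_hom_on_nonzero:
  assumes "\<sigma> \<in> ring_hom (ring_on M) (ring_on M')" "field (ring_on M)" "a \<in> M" "a \<noteq> 0"
  shows "\<sigma> a \<noteq> 0"
proof -
  have "\<sigma> a * \<sigma> (inverse a) = 1"
    using ring_hom_onD(2,4)[OF assms(1)] subfield_inverse[OF assms(2,3)] assms(3,4)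
    by (metis right_inverse)
  then show ?thesis by auto
qed

lemma ring_hom_on_inverse:
  assumes "\<sigma> \<in> ring_hom (ring_on M) (ring_on M')" "field (ring_on M)" "a \<in> M"
  shows "\<sigma> (inverse a) = inverse (\<sigma> a)"
proof (cases "a = 0")
  case True
  then show ?thesis using ring_hom_on_0[OF assms(1) subfield_subring[OF assms(2)]] by simp
next
  case False
  have "\<sigma> a * \<sigma> (inverse a) = \<sigma> (a * inverse a)"
    using ring_hom_onD(4)[OF assms(1,3) subfield_inverse[OF assms(2,3)]] by simp
  then have "\<sigma> a * \<sigma> (inverse a) = 1" using False ring_hom_onD(2)[OF assms(1)] by simp
  then show ?thesis by (metis inverse_unique)
qed

section \<open>Independence of monomials in an exponential and primitives\<close>

text \<open>
  Linear independence over \<open>C\<close> of the classes of \<open>B\<close> in the quotient by \<open>M\<close>; distinct elements of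
  \<open>B\<close> have distinct classes when \<open>C\<close> is a field.
\<close>
definition indep_mod :: "'a::field set \<Rightarrow> 'a set \<Rightarrow> 'a set \<Rightarrow> bool" where
  "indep_mod C M B \<longleftrightarrow>
     (\<forall>B0 c. finite B0 \<and> B0 \<subseteq> B \<and> (\<forall>b\<in>B0. c b \<in> C) \<and> (\<Sum>b\<in>B0. c b * b) \<in> M \<longrightarrow>
        (\<forall>b\<in>B0. c b = 0))"

lemma indep_modD:
  assumes "indep_mod C M B" "finite B0" "B0 \<subseteq> B" "\<And>b. b \<in> B0 \<Longrightarrow> c b \<in> C" "(\<Sum>b\<in>B0. c b * b) \<in> M"
    and "b \<in> B0"
  shows "c b = 0"
proof -
  have "finite B0 \<and> B0 \<subseteq> B \<and> (\<forall>b\<in>B0. c b \<in> C) \<and> (\<Sum>b\<in>B0. c b * b) \<in> M"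
    using assms(2-5) by simp
  from assms(1)[unfolded indep_mod_def, rule_format, OF this assms(6)] show ?thesis .
qed

lemma indep_mod_subset: "indep_mod C M B \<Longrightarrow> B' \<subseteq> B \<Longrightarrow> indep_mod C M B'"
  unfolding indep_mod_def by (meson order_trans)

text \<open>
  Translation by elements of \<open>M\<close> does not change classes modulo \<open>M\<close>.
\<close>
lemma indep_mod_translate:
  assumes C: "field (ring_on C)" "C \<subseteq> M" and M: "field (ring_on M)"
    and B: "indep_mod C M B" and t: "inj_on t B" "\<And>b. b \<in> B \<Longrightarrow> t b - b \<in> M"
  shows "indep_mod C M (t ` B)"
  unfolding indep_mod_def
proof (intro allI impI)
  fix B0 c
  assume a: "finite B0 \<and> B0 \<subseteq> t ` B \<and> (\<forall>b\<in>B0. c b \<in> C) \<and> (\<Sum>b\<in>B0. c b * b) \<in> M"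
  then have "finite B0" "B0 \<subseteq> t ` B" by auto
  then obtain B1 where B1: "B1 \<subseteq> B" "finite B1" "B0 = t ` B1"
    by (auto dest: finite_subset_image)
  have c: "c (t b) \<in> C" if "b \<in> B1" for b using a that B1(3) by auto
  note M_sub = subfield_subring[OF M]
  have "(\<Sum>b\<in>B1. c (t b) * b) = (\<Sum>b\<in>B0. c b * b) - (\<Sum>b\<in>B1. c (t b) * (t b - b))"
    unfolding B1(3) using inj_on_subset[OF t(1) B1(1)]
    by (simp add: sum.reindex algebra_simps sum_subtractf)
  also have "\<dots> \<in> M"
  proof (rule subring_set_closed(1)[OF M_sub])
    show "(\<Sum>b\<in>B0. c b * b) \<in> M" using a by simp
    have "c (t b) * (t b - b) \<in> M" if "b \<in> B1" for b
      using c[OF that] t(2)[of b] that B1(1) C(2) by (intro subring_setD(5)[OF M_sub]) auto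
    then show "(\<Sum>b\<in>B1. c (t b) * (t b - b)) \<in> M" by (rule subring_set_closed(4)[OF M_sub])
  qed
  finally have "c (t b) = 0" if "b \<in> B1" for b
    by (intro indep_modD[OF B B1(2,1) c, of "\<lambda>b. b"] that)
  then show "\<forall>b\<in>B0. c b = 0" by (simp add: B1(3))
qed

text \<open>
  A basis of the image of \<open>Z\<close> modulo \<open>M\<close>, chosen inside \<open>Z\<close>.  Independence has finite character, so
  Zorn's lemma applies; by maximality an enlarged set is dependent, and the dependence can be solved
  for the new element.
\<close>
lemma indep_mod_maximal:
  assumes C: "field (ring_on C)" "C \<subseteq> M" and M: "field (ring_on M)"
  shows "\<exists>B\<subseteq>Z. indep_mod C M B \<and>
    (\<forall>z\<in>Z. \<exists>B1 e. finite B1 \<and> B1 \<subseteq> B \<and> (\<forall>b\<in>B1. e b \<in> C) \<and> z - (\<Sum>b\<in>B1. e b * b) \<in> M)"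
proof -
  note C_ring = subring_setD[OF subfield_subring[OF C(1)]]
  note M_ring = subring_setD[OF subfield_subring[OF M]]
  have "\<exists>B\<in>{B. B \<subseteq> Z \<and> indep_mod C M B}. \<forall>X\<in>{B. B \<subseteq> Z \<and> indep_mod C M B}. B \<subseteq> X \<longrightarrow> X = B"
  proof (rule subset_Zorn_nonempty)
    show "{B. B \<subseteq> Z \<and> indep_mod C M B} \<noteq> {}"
      by (auto intro!: exI[of _ "{}"] simp: indep_mod_def)
    fix \<C> assume ne: "\<C> \<noteq> {}" and ch: "subset.chain {B. B \<subseteq> Z \<and> indep_mod C M B} \<C>"
    then have sub: "\<C> \<subseteq> {B. B \<subseteq> Z \<and> indep_mod C M B}" by (simp add: subset.chain_def)
    have "indep_mod C M (\<Union>\<C>)"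
      unfolding indep_mod_def
    proof (intro allI impI)
      fix B0 c
      assume a: "finite B0 \<and> B0 \<subseteq> \<Union>\<C> \<and> (\<forall>b\<in>B0. c b \<in> C) \<and> (\<Sum>b\<in>B0. c b * b) \<in> M"
      then have "finite B0" "B0 \<subseteq> \<Union>\<C>" by auto
      then obtain X where "X \<in> \<C>" "B0 \<subseteq> X"
        by (rule finite_subset_Union_chain[OF _ _ ne ch])
      moreover from \<open>X \<in> \<C>\<close> have "indep_mod C M X" using sub by blast
      ultimately show "\<forall>b\<in>B0. c b = 0" using a by (intro ballI indep_modD[of C M X B0 c]) auto
    qed
    moreover have "\<Union>\<C> \<subseteq> Z" using sub by auto
    ultimately show "\<Union>\<C> \<in> {B. B \<subseteq> Z \<and> indep_mod C M B}" by simp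
  qed
  then obtain B where B: "B \<subseteq> Z" "indep_mod C M B"
    and max: "\<And>X. X \<subseteq> Z \<Longrightarrow> indep_mod C M X \<Longrightarrow> B \<subseteq> X \<Longrightarrow> X = B"
    by (auto elim!: bexE)
  have span: "\<exists>B1 e. finite B1 \<and> B1 \<subseteq> B \<and> (\<forall>b\<in>B1. e b \<in> C) \<and> z - (\<Sum>b\<in>B1. e b * b) \<in> M"
    if "z \<in> Z" for z
  proof (cases "z \<in> B")
    case True
    then show ?thesis
      using C_ring M_ring by (intro exI[of _ "{z}"] exI[of _ "\<lambda>_. 1"]) auto
  next
    case False
    then have "\<not> indep_mod C M (insert z B)" using max[of "insert z B"] B(1) \<open>z \<in> Z\<close> by auto
    then obtain B0 c where B0: "finite B0" "B0 \<subseteq> insert z B" "\<forall>b\<in>B0. c b \<in> C"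
      "(\<Sum>b\<in>B0. c b * b) \<in> M" "\<not> (\<forall>b\<in>B0. c b = 0)"
      unfolding indep_mod_def by blast
    have sub: "B0 - {z} \<subseteq> B" using B0(2) by auto
    have z: "z \<in> B0 \<and> c z \<noteq> 0"
    proof (rule ccontr)
      assume z0: "\<not> (z \<in> B0 \<and> c z \<noteq> 0)"
      then have "(\<Sum>b\<in>B0 - {z}. c b * b) = (\<Sum>b\<in>B0. c b * b)"
        using B0(1) by (intro sum.mono_neutral_left) auto
      then have "\<forall>b\<in>B0 - {z}. c b = 0"
        using B0 sub by (intro ballI indep_modD[OF B(2), of "B0 - {z}" c]) auto
      then show False using z0 B0(5) by auto
    qed
    define e where "e b = - c b / c z" for b
    have "e b \<in> C" if "b \<in> B0" for b
      unfolding e_def using B0(3) z that by (intro subfield_divide[OF C(1)] C_ring) auto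
    moreover have "z - (\<Sum>b\<in>B0 - {z}. e b * b) \<in> M"
    proof -
      have "z - (\<Sum>b\<in>B0 - {z}. e b * b) = (c z * z + (\<Sum>b\<in>B0 - {z}. c b * b)) / c z"
        using z by (simp add: e_def add_divide_distrib sum_divide_distrib sum_negf)
      also have "\<dots> = (\<Sum>b\<in>B0. c b * b) / c z"
        using z B0(1) by (simp add: sum.remove[of B0 z])
      also have "\<dots> \<in> M" using z B0 C(2) by (intro subfield_divide[OF M]) auto
      finally show ?thesis .
    qed
    ultimately show ?thesis
      using B0(1) sub by (intro exI[of _ "B0 - {z}"] exI[of _ e] conjI ballI) simp_all
  qed
  show ?thesis by (intro exI[of _ B] conjI ballI B span)
qed

lemma finite_bounded_multisets:
  assumes "finite B"
  shows "finite {\<alpha>. set_mset \<alpha> \<subseteq> B \<and> size \<alpha> < (d::nat)}"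
proof (induction d)
  case (Suc d)
  have "{\<alpha>. set_mset \<alpha> \<subseteq> B \<and> size \<alpha> < Suc d}
      \<subseteq> insert {#} (\<Union>b\<in>B. add_mset b ` {\<alpha>. set_mset \<alpha> \<subseteq> B \<and> size \<alpha> < d})"
  proof
    fix \<alpha> assume a: "\<alpha> \<in> {\<alpha>. set_mset \<alpha> \<subseteq> B \<and> size \<alpha> < Suc d}"
    show "\<alpha> \<in> insert {#} (\<Union>b\<in>B. add_mset b ` {\<alpha>. set_mset \<alpha> \<subseteq> B \<and> size \<alpha> < d})"
      using a by (cases \<alpha>) auto
  qed
  then show ?case using Suc assms by (meson finite_UN finite_imageI finite_insert finite_subset)
qed simp

context field_derivation
begin

text \<open>
  Differentiation of polynomials in the primitives \<open>b \<in> B\<close>, times an exponential \<open>z\<close>, in terms of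
  coefficients.  The coefficient at \<open>\<alpha>\<close> receives contributions from those at \<open>\<alpha>\<close> and from those one
  degree higher, so that the terms of highest degree are only differentiated and scaled.
\<close>
lemma der_combination:
  assumes B: "finite B" "B \<subseteq> U"
    and S: "finite S" "\<And>\<alpha>. \<alpha> \<in> S \<Longrightarrow> set_mset \<alpha> \<subseteq> B" "\<And>b \<alpha>. add_mset b \<alpha> \<in> S \<Longrightarrow> \<alpha> \<in> S"
    and z: "z \<in> U" "\<delta> z = s * z"
    and m: "\<And>\<alpha>. m \<alpha> \<in> U" "\<And>\<alpha>. \<alpha> \<notin> S \<Longrightarrow> m \<alpha> = 0"
  shows "\<delta> (\<Sum>\<alpha>\<in>S. m \<alpha> * (z * \<Prod>\<^sub># \<alpha>)) =
    (\<Sum>\<alpha>\<in>S. (\<delta> (m \<alpha>) + s * m \<alpha> +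
        (\<Sum>b\<in>B. of_nat (Suc (count \<alpha> b)) * \<delta> b * m (add_mset b \<alpha>))) * (z * \<Prod>\<^sub># \<alpha>))"
proof -
  have pU: "\<Prod>\<^sub># \<alpha> \<in> U" if "\<alpha> \<in> S" for \<alpha>
    using S(2)[OF that] B(2) by (intro U_ring) auto
  have shift: "(\<Sum>\<alpha>\<in>S. m \<alpha> * (of_nat (count \<alpha> b) * \<delta> b * \<Prod>\<^sub># (\<alpha> - {#b#})))
      = (\<Sum>\<beta>\<in>S. of_nat (Suc (count \<beta> b)) * \<delta> b * m (add_mset b \<beta>) * \<Prod>\<^sub># \<beta>)" (is "?l = ?r") for b
  proof -
    have "?l = (\<Sum>\<alpha>\<in>{\<alpha>\<in>S. b \<in># \<alpha>}. m \<alpha> * (of_nat (count \<alpha> b) * \<delta> b * \<Prod>\<^sub># (\<alpha> - {#b#})))"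
      using S(1) by (intro sum.mono_neutral_right) (auto simp: not_in_iff)
    also have "\<dots> = (\<Sum>\<beta>\<in>{\<beta>\<in>S. add_mset b \<beta> \<in> S}.
        of_nat (Suc (count \<beta> b)) * \<delta> b * m (add_mset b \<beta>) * \<Prod>\<^sub># \<beta>)"
    proof (rule sum.reindex_bij_witness[of _ "add_mset b" "\<lambda>\<alpha>. \<alpha> - {#b#}"])
      fix \<alpha> assume a: "\<alpha> \<in> {\<alpha> \<in> S. b \<in># \<alpha>}"
      then obtain \<beta> where "\<alpha> = add_mset b \<beta>" by (metis (no_types, lifting) insert_DiffM mem_Collect_eq)
      then show "add_mset b (\<alpha> - {#b#}) = \<alpha>" "\<alpha> - {#b#} \<in> {\<beta> \<in> S. add_mset b \<beta> \<in> S}"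
        "of_nat (Suc (count (\<alpha> - {#b#}) b)) * \<delta> b * m (add_mset b (\<alpha> - {#b#})) * \<Prod>\<^sub># (\<alpha> - {#b#})
          = m \<alpha> * (of_nat (count \<alpha> b) * \<delta> b * \<Prod>\<^sub># (\<alpha> - {#b#}))"
        using a S(3) by auto
    qed auto
    also have "\<dots> = ?r"
      using S(1) m(2) by (intro sum.mono_neutral_left) auto
    finally show ?thesis .
  qed
  have "\<delta> (\<Sum>\<alpha>\<in>S. m \<alpha> * (z * \<Prod>\<^sub># \<alpha>)) = (\<Sum>\<alpha>\<in>S. \<delta> (m \<alpha> * (z * \<Prod>\<^sub># \<alpha>)))"
    by (rule der_sum) (use pU z(1) m(1) in \<open>auto intro!: U_ring(5)\<close>)
  also have "\<dots> = (\<Sum>\<alpha>\<in>S. (\<delta> (m \<alpha>) + s * m \<alpha>) * (z * \<Prod>\<^sub># \<alpha>)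
      + z * (\<Sum>b\<in>B. m \<alpha> * (of_nat (count \<alpha> b) * \<delta> b * \<Prod>\<^sub># (\<alpha> - {#b#}))))"
  proof (rule sum.cong[OF refl])
    fix \<alpha> assume a: "\<alpha> \<in> S"
    have "\<delta> (m \<alpha> * (z * \<Prod>\<^sub># \<alpha>)) = (\<delta> (m \<alpha>) + s * m \<alpha>) * (z * \<Prod>\<^sub># \<alpha>) + z * (m \<alpha> * \<delta> (\<Prod>\<^sub># \<alpha>))"
      using m(1)[of \<alpha>] z pU[OF a] by (simp add: der_mult U_ring algebra_simps)
    then show "\<delta> (m \<alpha> * (z * \<Prod>\<^sub># \<alpha>)) = (\<delta> (m \<alpha>) + s * m \<alpha>) * (z * \<Prod>\<^sub># \<alpha>)
      + z * (\<Sum>b\<in>B. m \<alpha> * (of_nat (count \<alpha> b) * \<delta> b * \<Prod>\<^sub># (\<alpha> - {#b#})))"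
      by (simp only: der_prod_mset[OF B(1) S(2)[OF a] B(2)] sum_distrib_left)
  qed
  also have "\<dots> = (\<Sum>\<alpha>\<in>S. (\<delta> (m \<alpha>) + s * m \<alpha>) * (z * \<Prod>\<^sub># \<alpha>))
      + z * (\<Sum>b\<in>B. \<Sum>\<alpha>\<in>S. m \<alpha> * (of_nat (count \<alpha> b) * \<delta> b * \<Prod>\<^sub># (\<alpha> - {#b#})))"
    by (simp only: sum.distrib sum_distrib_left[of z] sum.swap[of _ S B])
  also have "\<dots> = (\<Sum>\<alpha>\<in>S. (\<delta> (m \<alpha>) + s * m \<alpha> +
        (\<Sum>b\<in>B. of_nat (Suc (count \<alpha> b)) * \<delta> b * m (add_mset b \<alpha>))) * (z * \<Prod>\<^sub># \<alpha>))"
    unfolding shift sum.swap[of _ S B]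
    by (simp only: sum.distrib[symmetric] sum_distrib_left)
       (rule sum.cong[OF refl],
        simp only: distrib_right distrib_left sum_distrib_right sum_distrib_left mult_ac)
  finally show ?thesis .
qed

text \<open>
  A form of the Kolchin-Ostrowski theorem.  The proof is by induction on the degree
  bound \<open>d\<close> in the primitives and then on the number of nonzero coefficients of highest degree.
  A relation with leading coefficient \<open>1\<close> at \<open>(k0, \<alpha>0)\<close> is differentiated, and \<open>k0 r\<close> times the
  relation is subtracted.  This kills the chosen coefficient and creates no new ones of highest
  degree, so by induction all coefficients of the result vanish.  In highest degree this says that
  \<open>n k \<alpha> \<zeta>\<^bsup>k - k0\<^esup>\<close> is a constant, hence in \<open>M\<close>, which is impossible for \<open>k \<noteq> k0\<close>; so only \<open>k0\<close>
  occurs, with constant coefficients.  One degree lower, the vanishing says that a constant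
  combination of \<open>B\<close> plus an element of \<open>M\<close> has derivative zero, contradicting independence
  modulo \<open>M\<close>.
\<close>
lemma monomial_relation_trivial:
  assumes M: "field (ring_on M)" "M \<subseteq> U" "\<And>a. a \<in> M \<Longrightarrow> \<delta> a \<in> M" "constants \<delta> U \<subseteq> M"
    and \<zeta>: "\<zeta> \<in> U" "\<zeta> \<noteq> 0" "\<delta> \<zeta> = r * \<zeta>" "r \<in> M"
    and B: "finite B" "B \<subseteq> U" "\<And>b. b \<in> B \<Longrightarrow> \<delta> b \<in> M" "indep_mod (constants \<delta> U) M B"
    and J: "finite J" "\<And>k k'. k \<in> J \<Longrightarrow> k' \<in> J \<Longrightarrow> k < k' \<Longrightarrow> \<zeta> ^ (k' - k) \<notin> M"
    and m: "\<And>k \<alpha>. m k \<alpha> \<in> M"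
      "\<And>k \<alpha>. \<not> (k \<in> J \<and> set_mset \<alpha> \<subseteq> B \<and> size \<alpha> < d) \<Longrightarrow> m k \<alpha> = 0"
    and rel: "(\<Sum>k\<in>J. \<Sum>\<alpha> | set_mset \<alpha> \<subseteq> B \<and> size \<alpha> < d. m k \<alpha> * (\<zeta> ^ k * \<Prod>\<^sub># \<alpha>)) = 0"
  shows "m k \<alpha> = 0"
  using m rel
proof (induction d arbitrary: m k \<alpha>)
  case 0
  then show ?case by simp
next
  case (Suc d)
  define S where "S = {\<alpha>. set_mset \<alpha> \<subseteq> B \<and> size \<alpha> < Suc d}"
  have S: "finite S" "\<And>\<alpha>. \<alpha> \<in> S \<Longrightarrow> set_mset \<alpha> \<subseteq> B" "\<And>b \<alpha>. add_mset b \<alpha> \<in> S \<Longrightarrow> \<alpha> \<in> S"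
    using finite_bounded_multisets[OF B(1), of "Suc d"] by (auto simp: S_def)
  note M_ring = subring_setD[OF subfield_subring[OF M(1)]]
    subring_set_closed[OF subfield_subring[OF M(1)]]
  note M_closed = M_ring subfield_inverse[OF M(1)] subfield_divide[OF M(1)]
  have const: "c \<in> constants \<delta> U" if "c \<in> U" "\<delta> c = 0" for c
    using that by (simp add: constants_def)
  \<comment> \<open>the induction hypothesis for the smaller degree bound applies when this set is empty\<close>
  define leading where "leading m = {(k, \<alpha>). k \<in> J \<and> \<alpha> \<in> S \<and> size \<alpha> = d \<and> m k \<alpha> \<noteq> (0::'a)}" for m
  have finite_leading: "finite (leading m)" for m
    by (rule finite_subset[of _ "J \<times> S"]) (use J(1) S(1) in \<open>auto simp: leading_def\<close>)
  show ?case
    using Suc.prems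
  proof (induction "card (leading m)" arbitrary: m k \<alpha> rule: less_induct)
    case (less m)
    note m = less.prems(1,2)
    have rel: "(\<Sum>k\<in>J. \<Sum>\<alpha>\<in>S. m k \<alpha> * (\<zeta> ^ k * \<Prod>\<^sub># \<alpha>)) = 0"
      using less.prems(3) by (simp add: S_def)
    show ?case
    proof (cases "leading m = {}")
      case True
      have z: "m k \<alpha> = 0" if "\<not> (k \<in> J \<and> set_mset \<alpha> \<subseteq> B \<and> size \<alpha> < d)" for k \<alpha>
      proof (rule ccontr)
        assume nz: "m k \<alpha> \<noteq> 0"
        then have "k \<in> J \<and> set_mset \<alpha> \<subseteq> B \<and> size \<alpha> < Suc d" using m(2) by blast
        then have "(k, \<alpha>) \<in> leading m" using that nz by (auto simp: leading_def S_def)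
        then show False using True by simp
      qed
      have "(\<Sum>\<alpha>\<in>S. m k \<alpha> * (\<zeta> ^ k * \<Prod>\<^sub># \<alpha>))
          = (\<Sum>\<alpha> | set_mset \<alpha> \<subseteq> B \<and> size \<alpha> < d. m k \<alpha> * (\<zeta> ^ k * \<Prod>\<^sub># \<alpha>))" for k
        using S(1) z by (intro sum.mono_neutral_right) (auto simp: S_def)
      then show ?thesis using Suc.IH[OF m(1) z] rel by simp
    next
      case False
      then obtain k0 \<alpha>0 where top0: "(k0, \<alpha>0) \<in> leading m" by auto
      have t0: "k0 \<in> J" "\<alpha>0 \<in> S" "size \<alpha>0 = d" "m k0 \<alpha>0 \<noteq> 0"
        using top0 by (auto simp: leading_def)
      \<comment> \<open>normalise one leading coefficient to 1, so that its derivative vanishes\<close>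
      define n where "n k \<alpha> = m k \<alpha> / m k0 \<alpha>0" for k \<alpha>
      have nM: "n k \<alpha> \<in> M" for k \<alpha> unfolding n_def by (intro M_closed m)
      have n0: "n k \<alpha> = 0" if "\<not> (k \<in> J \<and> \<alpha> \<in> S)" for k \<alpha>
        using m(2)[of k \<alpha>] that by (auto simp: n_def S_def)
      have n1: "n k0 \<alpha>0 = 1" using t0 by (simp add: n_def)
      have nrel: "(\<Sum>k\<in>J. \<Sum>\<alpha>\<in>S. n k \<alpha> * (\<zeta> ^ k * \<Prod>\<^sub># \<alpha>)) = 0"
      proof -
        have "(\<Sum>k\<in>J. \<Sum>\<alpha>\<in>S. n k \<alpha> * (\<zeta> ^ k * \<Prod>\<^sub># \<alpha>))
            = (\<Sum>k\<in>J. \<Sum>\<alpha>\<in>S. m k \<alpha> * (\<zeta> ^ k * \<Prod>\<^sub># \<alpha>)) / m k0 \<alpha>0"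
          by (simp add: n_def sum_divide_distrib)
        then show ?thesis using rel by simp
      qed
      \<comment> \<open>\<open>e\<close> are the coefficients of the derivative, and \<open>q\<close> those after subtracting \<open>k0 r\<close> times the relation\<close>
      define e where "e k \<alpha> = \<delta> (n k \<alpha>) + of_nat k * r * n k \<alpha> +
        (\<Sum>b\<in>B. of_nat (Suc (count \<alpha> b)) * \<delta> b * n k (add_mset b \<alpha>))" for k \<alpha>
      define q where "q k \<alpha> = e k \<alpha> - of_nat k0 * r * n k \<alpha>" for k \<alpha>
      have qM: "q k \<alpha> \<in> M" for k \<alpha>
        unfolding q_def e_def
        using nM M(3) B(3) \<zeta>(4) by (intro M_ring) auto
      have q0: "q k \<alpha> = 0" if "\<not> (k \<in> J \<and> set_mset \<alpha> \<subseteq> B \<and> size \<alpha> < Suc d)" for k \<alpha>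
      proof -
        have "n k \<alpha> = 0" "\<And>b. n k (add_mset b \<alpha>) = 0"
          using that by (auto intro!: n0 simp: S_def)
        then show ?thesis by (simp add: q_def e_def der_0)
      qed
      have qrel: "(\<Sum>k\<in>J. \<Sum>\<alpha>\<in>S. q k \<alpha> * (\<zeta> ^ k * \<Prod>\<^sub># \<alpha>)) = 0"
      proof -
        have pU: "\<Prod>\<^sub># \<alpha> \<in> U" if "\<alpha> \<in> S" for \<alpha>
          using S(2)[OF that] B(2) by (intro U_ring) auto
        have inU: "n k \<alpha> * (\<zeta> ^ k * \<Prod>\<^sub># \<alpha>) \<in> U" if "\<alpha> \<in> S" for k \<alpha>
          using nM[of k \<alpha>] M(2) pU[OF that] \<zeta>(1) by (auto intro!: U_ring)
        have "0 = \<delta> (\<Sum>k\<in>J. \<Sum>\<alpha>\<in>S. n k \<alpha> * (\<zeta> ^ k * \<Prod>\<^sub># \<alpha>))"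
          using nrel der_0 by simp
        also have "\<dots> = (\<Sum>k\<in>J. \<delta> (\<Sum>\<alpha>\<in>S. n k \<alpha> * (\<zeta> ^ k * \<Prod>\<^sub># \<alpha>)))"
          by (rule der_sum) (auto intro!: U_ring(9) inU)
        also have "\<dots> = (\<Sum>k\<in>J. \<Sum>\<alpha>\<in>S. e k \<alpha> * (\<zeta> ^ k * \<Prod>\<^sub># \<alpha>))"
        proof (rule sum.cong[OF refl])
          fix k
          show "\<delta> (\<Sum>\<alpha>\<in>S. n k \<alpha> * (\<zeta> ^ k * \<Prod>\<^sub># \<alpha>)) = (\<Sum>\<alpha>\<in>S. e k \<alpha> * (\<zeta> ^ k * \<Prod>\<^sub># \<alpha>))"
            unfolding e_def
            using \<zeta> nM M(2) n0
            by (intro der_combination[OF B(1,2) S]) (auto intro: U_ring der_power)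
        qed
        finally have "(\<Sum>k\<in>J. \<Sum>\<alpha>\<in>S. e k \<alpha> * (\<zeta> ^ k * \<Prod>\<^sub># \<alpha>)) = 0" by simp
        moreover have "(\<Sum>k\<in>J. \<Sum>\<alpha>\<in>S. q k \<alpha> * (\<zeta> ^ k * \<Prod>\<^sub># \<alpha>))
          = (\<Sum>k\<in>J. \<Sum>\<alpha>\<in>S. e k \<alpha> * (\<zeta> ^ k * \<Prod>\<^sub># \<alpha>))
            - of_nat k0 * r * (\<Sum>k\<in>J. \<Sum>\<alpha>\<in>S. n k \<alpha> * (\<zeta> ^ k * \<Prod>\<^sub># \<alpha>))"
          by (simp add: q_def left_diff_distrib sum_subtractf sum_distrib_left mult.assoc)
        ultimately show ?thesis using nrel by simp
      qed
      have q_top: "q k \<alpha> = \<delta> (n k \<alpha>) + (of_nat k - of_nat k0) * r * n k \<alpha>" if "size \<alpha> = d" for k \<alpha>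
      proof -
        have "n k (add_mset b \<alpha>) = 0" for b using that by (intro n0) (auto simp: S_def)
        then show ?thesis by (simp add: q_def e_def algebra_simps)
      qed
      have "leading q \<subset> leading m"
      proof
        show "leading q \<subseteq> leading m"
        proof (clarsimp simp: leading_def)
          fix k \<alpha> assume "\<alpha> \<in> S" "q k \<alpha> \<noteq> 0" "m k \<alpha> = 0" "d = size \<alpha>"
          then show False using q_top[of \<alpha> k] by (simp add: n_def der_0)
        qed
        have "(k0, \<alpha>0) \<notin> leading q" using q_top[OF t0(3), of k0] n1 der_1 by (simp add: leading_def)
        then show "leading q \<noteq> leading m" using top0 by blast
      qed
      then have "card (leading q) < card (leading m)" by (rule psubset_card_mono[OF finite_leading])
      from less.hyps[OF this qM q0] have q_zero: "q k \<alpha> = 0" for k \<alpha>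
        using qrel by (simp add: S_def)
      have top_k: "k = k0" if "size \<alpha> = d" "n k \<alpha> \<noteq> 0" for k \<alpha>
      proof (rule ccontr)
        assume "k \<noteq> k0"
        have kJ: "k \<in> J" using that n0 by blast
        have dn: "\<delta> (n k \<alpha>) = (of_nat k0 - of_nat k) * r * n k \<alpha>"
          using q_top[OF that(1), of k] q_zero[of k \<alpha>] by (simp add: algebra_simps eq_neg_iff_add_eq_0)
        have nU: "n k \<alpha> \<in> U" using nM M(2) by auto
        \<comment> \<open>a constant, from which the power of \<open>\<zeta>\<close> with exponent \<open>k - k0\<close> or \<open>k0 - k\<close> is recovered inside \<open>M\<close>\<close>
        let ?c = "n k \<alpha> * \<zeta> ^ k / \<zeta> ^ k0"
        have "\<delta> ?c = 0"
          using nU \<zeta>(1,2)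
          by (simp add: der_divide der_mult U_ring dn der_power[OF \<zeta>(1,3)] algebra_simps)
        then have "?c \<in> constants \<delta> U" using nU \<zeta>(1) by (intro const U_closed)
        then have c: "?c \<in> M" using M(4) by auto
        show False
        proof (cases "k < k0")
          case True
          have "\<zeta> ^ k0 = \<zeta> ^ k * \<zeta> ^ (k0 - k)" using True by (simp flip: power_add)
          then have "\<zeta> ^ (k0 - k) = n k \<alpha> / ?c" using \<zeta>(2) that(2) by (simp add: field_simps)
          also have "\<dots> \<in> M" by (intro M_closed nM c)
          finally show False using J(2)[OF kJ t0(1) True] by simp
        next
          case False
          then have lt: "k0 < k" using \<open>k \<noteq> k0\<close> by simp
          have "\<zeta> ^ k = \<zeta> ^ k0 * \<zeta> ^ (k - k0)" using lt by (simp flip: power_add)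
          then have "\<zeta> ^ (k - k0) = ?c / n k \<alpha>" using \<zeta>(2) that(2) by (simp add: field_simps)
          also have "\<dots> \<in> M" by (intro M_closed nM c)
          finally show False using J(2)[OF t0(1) kJ lt] by simp
        qed
      qed
      have top_const: "n k0 \<alpha> \<in> constants \<delta> U" if "size \<alpha> = d" for \<alpha>
        using q_top[OF that, of k0] q_zero[of k0 \<alpha>] nM M(2) by (intro const) auto
      show ?thesis
      proof (cases \<alpha>0)
        case empty
        then have "d = 0" using t0(3) by simp
        have "S = {{#}}" using \<open>d = 0\<close> by (auto simp: S_def)
        have "n k {#} = 0" if "k \<noteq> k0" for k using top_k[of "{#}" k] that \<open>d = 0\<close> by auto
        then have "(\<Sum>k\<in>J. n k {#} * \<zeta> ^ k) = (\<Sum>k\<in>{k0}. n k {#} * \<zeta> ^ k)"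
          using t0(1) J(1) by (intro sum.mono_neutral_right) auto
        moreover have "(\<Sum>k\<in>J. n k {#} * \<zeta> ^ k) = 0"
          using nrel by (simp add: \<open>S = {{#}}\<close>)
        ultimately show ?thesis using n1 empty \<zeta>(2) by simp
      next
        case (add b0 \<beta>)
        have \<beta>: "Suc (size \<beta>) = d" "b0 \<in> B" using add t0 by (auto simp: S_def)
        \<comment> \<open>the coefficient of \<open>\<delta> b\<close> in \<open>q\<close> at \<open>\<beta> = \<alpha>0 - {#b0#}\<close>; at \<open>b0\<close> it is a positive integer, nonzero in characteristic zero\<close>
        define c where "c b = of_nat (Suc (count \<beta> b)) * n k0 (add_mset b \<beta>)" for b
        have cC: "c b \<in> constants \<delta> U" for b
        proof -
          have "n k0 (add_mset b \<beta>) \<in> constants \<delta> U" using \<beta>(1) by (intro top_const) simp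
          then show ?thesis unfolding c_def constants_def
            by (simp add: der_mult der_of_nat U_ring del: of_nat_Suc)
        qed
        have cU: "c b \<in> U" "\<delta> (c b) = 0" for b using cC[of b] by (auto simp: constants_def)
        let ?w = "n k0 \<beta> + (\<Sum>b\<in>B. c b * b)"
        have wU: "?w \<in> U" using nM[of k0 \<beta>] M(2) B(2) cU by (auto intro!: U_ring)
        have "\<delta> (\<Sum>b\<in>B. c b * b) = (\<Sum>b\<in>B. \<delta> (c b * b))"
          using B(2) cU by (intro der_sum U_ring) auto
        also have "\<dots> = (\<Sum>b\<in>B. c b * \<delta> b)"
          using B(2) cU by (intro sum.cong) (auto simp: der_mult)
        finally have "\<delta> ?w = \<delta> (n k0 \<beta>) + (\<Sum>b\<in>B. c b * \<delta> b)"
          using nM[of k0 \<beta>] M(2) B(2) cU by (subst der_add) (auto intro!: U_ring)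
        also have "\<dots> = q k0 \<beta>"
          by (simp add: q_def e_def c_def mult_ac)
        finally have "?w \<in> M" using q_zero[of k0 \<beta>] const[OF wU] M(4) by auto
        then have "?w - n k0 \<beta> \<in> M" using nM by (rule M_ring)
        then have "c b0 = 0"
          using B(4)[unfolded indep_mod_def] B(1) cC \<beta>(2) by auto
        moreover have "c b0 = of_nat (Suc (count \<beta> b0))" using n1 add by (simp add: c_def)
        ultimately show ?thesis by (simp del: of_nat_Suc)
      qed
    qed
  qed
qed

end

text \<open>
  The exponent \<open>k\<close> stays below the least positive \<open>j\<close> with \<open>\<zeta>\<^sup>j \<in> M\<close>, or is arbitrary if there is
  none; the two cases need not be distinguished.
\<close>
definition monomials :: "'a::field set \<Rightarrow> 'a \<Rightarrow> 'a set \<Rightarrow> (nat \<times> 'a multiset) set" where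
  "monomials M \<zeta> B = {k. \<forall>j. 0 < j \<and> j \<le> k \<longrightarrow> \<zeta> ^ j \<notin> M} \<times> {\<alpha>. set_mset \<alpha> \<subseteq> B}"

definition monomial :: "'a::field \<Rightarrow> nat \<times> 'a multiset \<Rightarrow> 'a" where
  "monomial \<zeta> i = \<zeta> ^ fst i * \<Prod>\<^sub># (snd i)"

text \<open>
  Only finitely many exponents and primitives occur in a given relation, so \<open>B\<close> may be infinite.
\<close>
lemma (in field_derivation) monomials_independent:
  assumes M: "field (ring_on M)" "M \<subseteq> U" "\<And>a. a \<in> M \<Longrightarrow> \<delta> a \<in> M" "constants \<delta> U \<subseteq> M"
    and \<zeta>: "\<zeta> \<in> U" "\<zeta> \<noteq> 0" "\<delta> \<zeta> = r * \<zeta>" "r \<in> M"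
    and B: "B \<subseteq> U" "\<And>b. b \<in> B \<Longrightarrow> \<delta> b \<in> M" "indep_mod (constants \<delta> U) M B"
    and I: "finite I" "I \<subseteq> monomials M \<zeta> B"
    and c: "\<And>i. c i \<in> M" "\<And>i. i \<notin> I \<Longrightarrow> c i = 0"
    and rel: "(\<Sum>i\<in>I. c i * monomial \<zeta> i) = 0"
  shows "c i = 0"
proof -
  define B0 where "B0 = (\<Union>i\<in>I. set_mset (snd i))"
  define d where "d = Suc (\<Sum>i\<in>I. size (snd i))"
  have I_bound: "k \<in> fst ` I \<and> set_mset \<alpha> \<subseteq> B0 \<and> size \<alpha> < d" if "(k, \<alpha>) \<in> I" for k \<alpha>
  proof -
    have "size \<alpha> \<le> (\<Sum>i\<in>I. size (snd i))"
      using member_le_sum[of "(k, \<alpha>)" I "\<lambda>i. size (snd i)"] that I(1) by simp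
    moreover have "set_mset \<alpha> \<subseteq> B0" using that by (force simp: B0_def)
    moreover have "k \<in> fst ` I" using that by force
    ultimately show ?thesis by (simp add: d_def)
  qed
  have B0: "finite B0" "B0 \<subseteq> B" using I by (force simp: B0_def monomials_def)+
  let ?S = "{\<alpha>. set_mset \<alpha> \<subseteq> B0 \<and> size \<alpha> < d}"
  have "(\<Sum>k\<in>fst ` I. \<Sum>\<alpha>\<in>?S. c (k, \<alpha>) * (\<zeta> ^ k * \<Prod>\<^sub># \<alpha>))
      = (\<Sum>i\<in>fst ` I \<times> ?S. c i * monomial \<zeta> i)"
    by (simp add: sum.cartesian_product monomial_def case_prod_unfold)
  also have "\<dots> = (\<Sum>i\<in>I. c i * monomial \<zeta> i)"
    using I(1) finite_bounded_multisets[OF B0(1), of d] I_bound c(2)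
    by (intro sum.mono_neutral_right) auto
  finally have rel': "(\<Sum>k\<in>fst ` I. \<Sum>\<alpha>\<in>?S. c (k, \<alpha>) * (\<zeta> ^ k * \<Prod>\<^sub># \<alpha>)) = 0"
    using rel by simp
  have "c (k, \<alpha>) = 0" for k \<alpha>
  proof (rule monomial_relation_trivial[where m = "\<lambda>k \<alpha>. c (k, \<alpha>)", OF M \<zeta> B0(1) _ _ _ _ _ _ _ rel'])
    show "B0 \<subseteq> U" "\<And>b. b \<in> B0 \<Longrightarrow> \<delta> b \<in> M" using B0 B by auto
    show "indep_mod (constants \<delta> U) M B0"
      by (rule indep_mod_subset[OF B(3) B0(2)])
    show "\<zeta> ^ (k' - k) \<notin> M" if "k \<in> fst ` I" "k' \<in> fst ` I" "k < k'" for k k'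
    proof -
      obtain \<alpha> where "(k', \<alpha>) \<in> I" using \<open>k' \<in> fst ` I\<close> by auto
      then have "\<forall>j. 0 < j \<and> j \<le> k' \<longrightarrow> \<zeta> ^ j \<notin> M" using I(2) by (auto simp: monomials_def)
      then show ?thesis using \<open>k < k'\<close> by simp
    qed
    show "c (k, \<alpha>) = 0" if "\<not> (k \<in> fst ` I \<and> set_mset \<alpha> \<subseteq> B0 \<and> size \<alpha> < d)" for k \<alpha>
      using c(2) I_bound that by blast
  qed (use I c in auto)
  then show ?thesis by (cases i) simp
qed

text \<open>
  Differential automorphisms act on the exponential by a constant factor \<open>e\<close> and on the primitives
  by constant translations \<open>t\<close>.  The new exponential and primitives satisfy the same hypotheses as
  the old ones, so their monomials are independent as well; injectivity of \<open>t\<close> ensures that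
  different monomials stay different.
\<close>
lemma (in field_derivation) twisted_monomials_independent:
  assumes M: "field (ring_on M)" "M \<subseteq> U" "\<And>a. a \<in> M \<Longrightarrow> \<delta> a \<in> M"
    and C: "field (ring_on (constants \<delta> U))" "constants \<delta> U \<subseteq> M"
    and \<zeta>: "\<zeta> \<in> U" "\<zeta> \<noteq> 0" "\<delta> \<zeta> = r * \<zeta>" "r \<in> M"
    and B: "B \<subseteq> U" "\<And>b. b \<in> B \<Longrightarrow> \<delta> b \<in> M" "indep_mod (constants \<delta> U) M B"
    and I: "finite I" "I \<subseteq> monomials M \<zeta> B"
    and e: "e \<in> constants \<delta> U" "e \<noteq> 0"
    and t: "inj_on t B" "\<And>b. b \<in> B \<Longrightarrow> t b - b \<in> constants \<delta> U"
    and c: "\<And>i. c i \<in> M" "\<And>i. i \<notin> I \<Longrightarrow> c i = 0"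
    and rel: "(\<Sum>i\<in>I. c i * monomial (e * \<zeta>) (fst i, image_mset t (snd i))) = 0"
  shows "c i = 0"
proof -
  define \<phi> where "\<phi> i = (fst i :: nat, image_mset t (snd i))" for i
  have inj_t: "image_mset t \<alpha> = image_mset t \<beta> \<Longrightarrow> \<alpha> = \<beta>"
    if "set_mset \<alpha> \<subseteq> B" "set_mset \<beta> \<subseteq> B" for \<alpha> \<beta>
  proof -
    have inv: "image_mset (the_inv_into B t) (image_mset t \<gamma>) = \<gamma>" if "set_mset \<gamma> \<subseteq> B" for \<gamma>
    proof -
      have "image_mset (\<lambda>b. the_inv_into B t (t b)) \<gamma> = image_mset (\<lambda>b. b) \<gamma>"
        using the_inv_into_f_f[OF t(1)] that by (intro image_mset_cong) auto
      then show ?thesis by (simp add: multiset.map_comp comp_def)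
    qed
    assume "image_mset t \<alpha> = image_mset t \<beta>"
    then have "image_mset (the_inv_into B t) (image_mset t \<alpha>) = image_mset (the_inv_into B t) (image_mset t \<beta>)"
      by (rule arg_cong)
    then show "\<alpha> = \<beta>" by (simp only: inv[OF that(1)] inv[OF that(2)])
  qed
  have inj: "inj_on \<phi> I"
  proof (rule inj_onI)
    fix i j assume ij: "i \<in> I" "j \<in> I" "\<phi> i = \<phi> j"
    have "set_mset (snd i) \<subseteq> B" "set_mset (snd j) \<subseteq> B"
      using subsetD[OF I(2) ij(1)] subsetD[OF I(2) ij(2)]
      by (simp_all add: monomials_def mem_Times_iff)
    moreover have "image_mset t (snd i) = image_mset t (snd j)" using ij(3) by (simp add: \<phi>_def)
    ultimately have "snd i = snd j" by (rule inj_t)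
    then show "i = j" using ij(3) by (simp add: \<phi>_def prod_eq_iff)
  qed
  define c' where "c' j = (if j \<in> \<phi> ` I then c (the_inv_into I \<phi> j) else 0)" for j
  have c': "c' (\<phi> i) = c i" if "i \<in> I" for i
    using that by (simp add: c'_def the_inv_into_f_f[OF inj])
  have eM: "e \<in> M" "e \<in> U" "\<delta> e = 0" using e C(2) M(2) by (auto simp: constants_def)
  have tU: "t b \<in> U \<and> \<delta> (t b) = \<delta> b" if "b \<in> B" for b
  proof -
    have tb: "t b - b \<in> U" "\<delta> (t b - b) = 0" and b: "b \<in> U"
      using t(2)[OF that] B(1) that by (auto simp: constants_def)
    then have "t b - b + b \<in> U" "\<delta> (t b - b + b) = 0 + \<delta> b"
      using b by (simp_all only: der_add U_ring)
    then show ?thesis by simp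
  qed
  have phi_I: "\<phi> ` I \<subseteq> monomials M (e * \<zeta>) (t ` B)"
  proof -
    have pow: "\<zeta> ^ j \<in> M" if "(e * \<zeta>) ^ j \<in> M" for j
    proof -
      have "\<zeta> ^ j = (e * \<zeta>) ^ j / e ^ j" using e(2) by (simp add: power_mult_distrib)
      also have "\<dots> \<in> M"
        using subring_set_closed(2)[OF subfield_subring[OF M(1)] eM(1)]
        by (rule subfield_divide[OF M(1) that])
      finally show ?thesis .
    qed
    show ?thesis
    proof
      fix j assume "j \<in> \<phi> ` I"
      then obtain i where "i \<in> I" "j = \<phi> i" by (rule imageE)
      then have "i \<in> monomials M \<zeta> B" "j = \<phi> i" using subsetD[OF I(2)] by simp_all
      then show "j \<in> monomials M (e * \<zeta>) (t ` B)"
        using pow by (auto simp: monomials_def mem_Times_iff \<phi>_def)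
    qed
  qed
  have "c' j = 0" for j
  proof (rule monomials_independent[where c = c', OF M C(2) _ _ _ \<zeta>(4) _ _ _ _ phi_I])
    show "e * \<zeta> \<in> U" "e * \<zeta> \<noteq> 0" "\<delta> (e * \<zeta>) = r * (e * \<zeta>)"
      using eM e \<zeta> by (auto simp: der_mult U_ring)
    show "t ` B \<subseteq> U" "\<And>b. b \<in> t ` B \<Longrightarrow> \<delta> b \<in> M" using tU B(2) by auto
    show "indep_mod (constants \<delta> U) M (t ` B)"
      using t(2) C(2) by (intro indep_mod_translate[OF C M(1) B(3) t(1)]) auto
    show "finite (\<phi> ` I)" using I(1) by simp
    show "c' j \<in> M" for j using c subring_setD(1)[OF subfield_subring[OF M(1)]] by (simp add: c'_def)
    show "j \<notin> \<phi> ` I \<Longrightarrow> c' j = 0" for j by (simp add: c'_def)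
    have "(\<Sum>j\<in>\<phi> ` I. c' j * monomial (e * \<zeta>) j) = (\<Sum>i\<in>I. c' (\<phi> i) * monomial (e * \<zeta>) (\<phi> i))"
      by (simp add: sum.reindex[OF inj])
    also have "\<dots> = (\<Sum>i\<in>I. c i * monomial (e * \<zeta>) (fst i, image_mset t (snd i)))"
      using c' by (intro sum.cong refl) (simp add: \<phi>_def)
    finally show "(\<Sum>j\<in>\<phi> ` I. c' j * monomial (e * \<zeta>) j) = 0" using rel by simp
  qed
  then show ?thesis using c'[of i] c(2)[of i] by (cases "i \<in> I") simp_all
qed

section \<open>Spans and the graph of a tensor product of homomorphisms\<close>

inductive_set lin_span :: "'a::field set \<Rightarrow> 'a set \<Rightarrow> 'a set" for R X where
  lin_span_0: "0 \<in> lin_span R X"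
| lin_span_add_term: "r \<in> R \<Longrightarrow> x \<in> X \<Longrightarrow> a \<in> lin_span R X \<Longrightarrow> r * x + a \<in> lin_span R X"

lemma lin_span_minimal:
  assumes "subring_set W" "R \<subseteq> W" "X \<subseteq> W"
  shows "lin_span R X \<subseteq> W"
proof
  fix a assume "a \<in> lin_span R X"
  then show "a \<in> W"
    by induction (use assms in \<open>auto intro!: subring_setD[OF assms(1)]\<close>)
qed

lemma lin_span_base: "r \<in> R \<Longrightarrow> x \<in> X \<Longrightarrow> r * x \<in> lin_span R X"
  using lin_span_add_term[OF _ _ lin_span_0] by fastforce

lemma lin_span_add:
  assumes "a \<in> lin_span R X" "b \<in> lin_span R X"
  shows "a + b \<in> lin_span R X"
  using assms(1) by induction (auto simp: add.assoc assms(2) lin_span_add_term)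

text \<open>
  The span is closed under multiplication because a power \<open>\<zeta>\<^sup>j \<in> R\<close> can be moved into the
  coefficient, which brings every exponent back into the permitted range.
\<close>
lemma lin_span_monomials:
  assumes R: "subring_set R"
  shows "subring_set (lin_span R (monomial \<zeta> ` monomials R \<zeta> B))" (is "subring_set ?A")
    and "R \<subseteq> lin_span R (monomial \<zeta> ` monomials R \<zeta> B)"
    and "\<zeta> \<in> lin_span R (monomial \<zeta> ` monomials R \<zeta> B)"
    and "B \<subseteq> lin_span R (monomial \<zeta> ` monomials R \<zeta> B)"
proof -
  note R_ring = subring_setD[OF R]
  have term_in: "r * (\<zeta> ^ k * \<Prod>\<^sub># \<alpha>) \<in> ?A" if "r \<in> R" and \<alpha>: "set_mset \<alpha> \<subseteq> B" for r k \<alpha>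
    using that(1)
  proof (induction k arbitrary: r rule: less_induct)
    case (less k)
    show ?case
    proof (cases "(k, \<alpha>) \<in> monomials R \<zeta> B")
      case True
      then have "monomial \<zeta> (k, \<alpha>) \<in> monomial \<zeta> ` monomials R \<zeta> B" by blast
      from lin_span_base[OF less.prems this] show ?thesis by (simp add: monomial_def)
    next
      case False
      then obtain j where j: "0 < j" "j \<le> k" "\<zeta> ^ j \<in> R"
        using \<alpha> by (auto simp: monomials_def)
      then have "\<zeta> ^ k = \<zeta> ^ j * \<zeta> ^ (k - j)" by (simp flip: power_add)
      moreover have "(r * \<zeta> ^ j) * (\<zeta> ^ (k - j) * \<Prod>\<^sub># \<alpha>) \<in> ?A"
        using j less.prems by (intro less.IH R_ring) auto
      ultimately show ?thesis by (simp add: mult_ac)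
    qed
  qed
  have mult_term: "a * (r * (\<zeta> ^ k * \<Prod>\<^sub># \<alpha>)) \<in> ?A"
    if "a \<in> ?A" "r \<in> R" "set_mset \<alpha> \<subseteq> B" for a r k \<alpha>
    using that(1)
  proof induction
    case (lin_span_add_term s x a)
    then obtain l \<beta> where x: "x = \<zeta> ^ l * \<Prod>\<^sub># \<beta>" "set_mset \<beta> \<subseteq> B"
      by (auto simp: monomials_def monomial_def)
    have "(s * r) * (\<zeta> ^ (l + k) * \<Prod>\<^sub># (\<beta> + \<alpha>)) \<in> ?A"
      using lin_span_add_term that x by (intro term_in R_ring) auto
    then have "s * x * (r * (\<zeta> ^ k * \<Prod>\<^sub># \<alpha>)) \<in> ?A"
      by (simp add: x power_add mult_ac)
    with lin_span_add_term.IH show ?case by (simp add: distrib_right lin_span_add)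
  qed (simp add: lin_span_0)
  have mult: "a * b \<in> ?A" if "a \<in> ?A" "b \<in> ?A" for a b
    using that(2)
  proof induction
    case (lin_span_add_term s x b)
    then have "a * (s * x) \<in> ?A"
      using mult_term[OF that(1)] by (auto simp: monomials_def monomial_def)
    with lin_span_add_term.IH show ?case by (simp add: distrib_left lin_span_add)
  qed (simp add: lin_span_0)
  show RA: "R \<subseteq> ?A"
  proof
    fix r assume "r \<in> R"
    then show "r \<in> ?A" using term_in[of r "{#}" 0] by simp
  qed
  show "\<zeta> \<in> ?A" using term_in[of 1 "{#}" 1] R_ring by simp
  show "B \<subseteq> ?A"
  proof
    fix b assume "b \<in> B"
    then show "b \<in> ?A" using term_in[of 1 "{#b#}" 0] R_ring by simp
  qed
  have uminus: "- a \<in> ?A" if "a \<in> ?A" for a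
  proof -
    have "- 1 \<in> ?A" using RA R_ring(2,3) by auto
    from mult[OF this that] show ?thesis by simp
  qed
  show "subring_set ?A"
    unfolding subring_set_def
    using subsetD[OF RA R_ring(2)]
    by (intro conjI ballI) (simp_all add: lin_span_0 uminus mult lin_span_add)
qed

text \<open>
  The pairs \<open>(\<Sum> m\<^sub>i x\<^sub>i, \<Sum> \<sigma> m\<^sub>i \<tau> x\<^sub>i)\<close>.  This is the graph of the desired map
  \<open>\<Sum> m\<^sub>i x\<^sub>i \<mapsto> \<Sum> \<sigma> m\<^sub>i \<tau> x\<^sub>i\<close>, taken as a relation because whether it is a function is what
  has to be proved.
\<close>
inductive paired_span :: "('a \<Rightarrow> 'a) \<Rightarrow> ('a \<Rightarrow> 'a) \<Rightarrow> 'a set \<Rightarrow> 'a set \<Rightarrow> 'a \<Rightarrow> 'a::field \<Rightarrow> bool"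
  for \<sigma> \<tau> M X where
  paired_span_0: "paired_span \<sigma> \<tau> M X 0 0"
| paired_span_add_term: "m \<in> M \<Longrightarrow> x \<in> X \<Longrightarrow> paired_span \<sigma> \<tau> M X a b \<Longrightarrow>
    paired_span \<sigma> \<tau> M X (m * x + a) (\<sigma> m * \<tau> x + b)"

lemma paired_span_base: "m \<in> M \<Longrightarrow> x \<in> X \<Longrightarrow> paired_span \<sigma> \<tau> M X (m * x) (\<sigma> m * \<tau> x)"
  using paired_span_add_term[OF _ _ paired_span_0] by fastforce

lemma paired_span_add:
  assumes "paired_span \<sigma> \<tau> M X a b" "paired_span \<sigma> \<tau> M X a' b'"
  shows "paired_span \<sigma> \<tau> M X (a + a') (b + b')"
  using assms(1) by induction (auto simp: add.assoc assms(2) paired_span_add_term)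

lemma paired_span_scale:
  assumes \<sigma>: "\<sigma> \<in> ring_hom (ring_on M) (ring_on M')" and M: "subring_set M"
    and "m \<in> M" "paired_span \<sigma> \<tau> M X a b"
  shows "paired_span \<sigma> \<tau> M X (m * a) (\<sigma> m * b)"
  using assms(4)
proof induction
  case (paired_span_add_term n x a b)
  have "paired_span \<sigma> \<tau> M X ((m * n) * x + m * a) (\<sigma> (m * n) * \<tau> x + \<sigma> m * b)"
    using paired_span_add_term assms(3)
    by (intro paired_span.paired_span_add_term subring_setD[OF M])
  then show ?case
    using ring_hom_onD(4)[OF \<sigma> assms(3) paired_span_add_term(1)] by (simp add: algebra_simps)
qed (simp add: paired_span_0)

lemma paired_span_uminus:
  assumes \<sigma>: "\<sigma> \<in> ring_hom (ring_on M) (ring_on M')" and M: "subring_set M"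
    and "paired_span \<sigma> \<tau> M X a b"
  shows "paired_span \<sigma> \<tau> M X (- a) (- b)"
proof -
  have "\<sigma> (- 1) = - 1"
    using ring_hom_on_uminus[OF \<sigma> M subring_setD(2)[OF M]] ring_hom_onD(2)[OF \<sigma>] by simp
  with paired_span_scale[OF \<sigma> M subring_setD(3)[OF M subring_setD(2)[OF M]] assms(3)]
  show ?thesis by simp
qed

lemma paired_span_mult_right:
  assumes \<tau>: "\<tau> \<in> ring_hom (ring_on N) (ring_on N')" and X: "subring_set X" "X \<subseteq> N"
    and "y \<in> X" "paired_span \<sigma> \<tau> M X a b"
  shows "paired_span \<sigma> \<tau> M X (a * y) (b * \<tau> y)"
  using assms(5)
proof induction
  case (paired_span_add_term m x a b)
  have "paired_span \<sigma> \<tau> M X (m * (x * y) + a * y) (\<sigma> m * \<tau> (x * y) + b * \<tau> y)"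
    using paired_span_add_term assms(4)
    by (intro paired_span.paired_span_add_term subring_setD[OF X(1)])
  moreover have "\<tau> (x * y) = \<tau> x * \<tau> y"
    using paired_span_add_term(2) assms(4) X(2) by (intro ring_hom_onD(4)[OF \<tau>]) auto
  ultimately show ?case by (simp add: algebra_simps)
qed (simp add: paired_span_0)

lemma paired_span_mult:
  assumes \<sigma>: "\<sigma> \<in> ring_hom (ring_on M) (ring_on M')" and M: "subring_set M"
    and \<tau>: "\<tau> \<in> ring_hom (ring_on N) (ring_on N')" and X: "subring_set X" "X \<subseteq> N"
    and "paired_span \<sigma> \<tau> M X a b" "paired_span \<sigma> \<tau> M X a' b'"
  shows "paired_span \<sigma> \<tau> M X (a * a') (b * b')"
  using assms(7)
proof induction
  case (paired_span_add_term m x a' b')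
  have "paired_span \<sigma> \<tau> M X (m * (a * x)) (\<sigma> m * (b * \<tau> x))"
    by (intro paired_span_scale[OF \<sigma> M] paired_span_mult_right[OF \<tau> X] paired_span_add_term assms(6))
  from paired_span_add[OF this paired_span_add_term.IH] show ?case
    by (simp add: algebra_simps)
qed (simp add: paired_span_0)

lemma paired_span_coordinates:
  assumes \<sigma>: "\<sigma> \<in> ring_hom (ring_on M) (ring_on M')" and M: "subring_set M"
    and "paired_span \<sigma> \<tau> M (f ` A) a b"
  shows "\<exists>I c. finite I \<and> I \<subseteq> A \<and> (\<forall>i. c i \<in> M) \<and> (\<forall>i. i \<notin> I \<longrightarrow> c i = 0) \<and>
    a = (\<Sum>i\<in>I. c i * f i) \<and> b = (\<Sum>i\<in>I. \<sigma> (c i) * \<tau> (f i))"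
  using assms(3)
proof induction
  case paired_span_0
  show ?case by (rule exI[of _ "{}"], rule exI[of _ "\<lambda>_. 0"]) (use subring_setD(1)[OF M] in auto)
next
  case (paired_span_add_term m x a b)
  then obtain I c where I: "finite I" "I \<subseteq> A" and c: "\<forall>i. c i \<in> M" "\<forall>i. i \<notin> I \<longrightarrow> c i = 0"
    and ab: "a = (\<Sum>i\<in>I. c i * f i)" "b = (\<Sum>i\<in>I. \<sigma> (c i) * \<tau> (f i))"
    by blast
  obtain j where j: "j \<in> A" "x = f j" using paired_span_add_term(2) by blast
  let ?I = "insert j I" and ?c = "c(j := m + c j)"
  have s0: "\<sigma> 0 = 0" by (rule ring_hom_on_0[OF \<sigma> M])
  have sj: "\<sigma> (m + c j) = \<sigma> m + \<sigma> (c j)"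
    using ring_hom_onD(3)[OF \<sigma>] paired_span_add_term(1) c(1) by blast
  have "a = (\<Sum>i\<in>?I. c i * f i)" "b = (\<Sum>i\<in>?I. \<sigma> (c i) * \<tau> (f i))"
    unfolding ab using I(1) c(2) s0 by (auto intro!: sum.mono_neutral_left)
  then have ab': "a = c j * f j + (\<Sum>i\<in>I - {j}. c i * f i)"
    "b = \<sigma> (c j) * \<tau> (f j) + (\<Sum>i\<in>I - {j}. \<sigma> (c i) * \<tau> (f i))"
    using I(1) by (simp_all add: sum.insert_remove)
  have "m * x + a = (\<Sum>i\<in>?I. ?c i * f i)" "\<sigma> m * \<tau> x + b = (\<Sum>i\<in>?I. \<sigma> (?c i) * \<tau> (f i))"
    using I(1) unfolding ab' j(2) by (simp_all add: sum.insert_remove sj algebra_simps)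
  moreover have "\<forall>i. ?c i \<in> M"
    using c(1) paired_span_add_term(1) subring_setD(4)[OF M] by simp
  ultimately show ?case using I j(1) c(2)
    by (intro exI[of _ ?I] exI[of _ ?c]) auto
qed

text \<open>
  Coefficients in \<open>R\<close> may be moved from the right factor to the left one since \<open>\<sigma>\<close> and \<open>\<tau>\<close> agree
  there.  This is where the compatibility of \<open>\<sigma>\<close> and \<open>\<tau>\<close> enters.
\<close>
lemma paired_span_lin_span:
  assumes \<sigma>: "\<sigma> \<in> ring_hom (ring_on M) (ring_on M')" and M: "subring_set M"
    and \<tau>: "\<tau> \<in> ring_hom (ring_on N) (ring_on N')" and N: "subring_set N"
    and R: "R \<subseteq> M" "R \<subseteq> N" "\<And>r. r \<in> R \<Longrightarrow> \<sigma> r = \<tau> r" and X: "X \<subseteq> N"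
    and ab: "paired_span \<sigma> \<tau> M (lin_span R X) a b"
  shows "paired_span \<sigma> \<tau> M X a b"
proof -
  have span_N: "p \<in> N" if "p \<in> lin_span R X" for p
    using lin_span_minimal[OF N R(2) X] that by blast
  have scaled: "paired_span \<sigma> \<tau> M X (m * p) (\<sigma> m * \<tau> p)" if "p \<in> lin_span R X" "m \<in> M" for m p
    using that(1)
  proof induction
    case lin_span_0
    show ?case using paired_span_0 by (simp add: ring_hom_on_0[OF \<tau> N])
  next
    case (lin_span_add_term r x p)
    have in_N: "r \<in> N" "x \<in> N" "p \<in> N" "r \<in> M"
      using lin_span_add_term R X span_N by auto
    have "\<tau> (r * x + p) = \<sigma> r * \<tau> x + \<tau> p"
      using in_N R(3)[OF lin_span_add_term(1)] ring_hom_onD(3,4)[OF \<tau>] subring_setD(5)[OF N]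
      by simp
    moreover have "paired_span \<sigma> \<tau> M X ((m * r) * x + m * p) (\<sigma> (m * r) * \<tau> x + \<sigma> m * \<tau> p)"
      using lin_span_add_term in_N that(2)
      by (intro paired_span_add_term subring_setD[OF M])
    ultimately show ?case
      using ring_hom_onD(4)[OF \<sigma> that(2) in_N(4)] by (simp add: algebra_simps)
  qed
  show ?thesis
    using ab
  proof induction
    case (paired_span_add_term m p a b)
    then show ?case by (intro paired_span_add scaled)
  qed (rule paired_span_0)
qed

lemma paired_span_clear_denominators:
  assumes \<sigma>: "\<sigma> \<in> ring_hom (ring_on M) (ring_on M')"
    and \<tau>: "\<tau> \<in> ring_hom (ring_on N) (ring_on N')" and N: "field (ring_on N)"
    and A: "subring_set A" "A \<subseteq> N" "N \<subseteq> fractions A"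
    and "paired_span \<sigma> \<tau> M N a b"
  shows "\<exists>D\<in>A. D \<noteq> 0 \<and> paired_span \<sigma> \<tau> M A (a * D) (b * \<tau> D)"
  using assms(7)
proof induction
  case paired_span_0
  show ?case using subring_setD(2)[OF A(1)] by (auto intro!: bexI[of _ 1] paired_span.paired_span_0)
next
  case (paired_span_add_term m n a b)
  then obtain D where D: "D \<in> A" "D \<noteq> 0" "paired_span \<sigma> \<tau> M A (a * D) (b * \<tau> D)" by blast
  obtain p q where pq: "p \<in> A" "q \<in> A" "q \<noteq> 0" "n = p / q"
    using paired_span_add_term(2) A(3) by (auto simp: fractions_def)
  have in_N: "p \<in> N" "q \<in> N" "D \<in> N" using pq D A(2) by auto
  have "\<tau> n * \<tau> q = \<tau> (n * q)"
    by (rule ring_hom_onD(4)[OF \<tau> paired_span_add_term(2) in_N(2), symmetric])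
  then have tn: "\<tau> n * \<tau> q = \<tau> p" using pq by simp
  have "paired_span \<sigma> \<tau> M A (m * (p * D)) (\<sigma> m * \<tau> (p * D))"
    using pq D paired_span_add_term(1) by (intro paired_span_base subring_setD[OF A(1)])
  from paired_span_add[OF this paired_span_mult_right[OF \<tau> A(1,2) pq(2) D(3)]]
  have "paired_span \<sigma> \<tau> M A ((m * n + a) * (D * q)) ((\<sigma> m * \<tau> n + b) * \<tau> (D * q))"
    using ring_hom_onD(4)[OF \<tau>] in_N tn pq(3,4) by (simp add: algebra_simps flip: tn)
  then show ?case using D pq subring_setD(5)[OF A(1)] by (intro bexI[of _ "D * q"]) auto
qed

section \<open>Linear disjointness over the intersection\<close>

text \<open>
  The implication from left to right expresses that \<open>M\<close> and \<open>N\<close> are linearly disjoint over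
  \<open>M \<inter> N\<close>.  The converse is not just the same implication for inverse maps, even if \<open>\<sigma>\<close> and \<open>\<tau>\<close>
  are bijective: agreement of \<open>\<sigma>\<close> and \<open>\<tau>\<close> on \<open>M \<inter> N\<close> gives agreement of the inverses only on the
  image of \<open>M \<inter> N\<close>, which might be smaller.  It follows instead from the independence of the
  monomials in the images of \<open>\<zeta>\<close> and of the primitives under \<open>\<tau>\<close>.
\<close>
lemma linearly_disjoint:
  fixes d :: "'i \<Rightarrow> 'a::field_char_0 \<Rightarrow> 'a"
  assumes U: "diff_subfield I d U" and M: "diff_subfield I d M" "M \<subseteq> U"
    and K: "diff_subfield I d K" "K \<subseteq> M"
    and o: "i\<^sub>0 \<in> I" "constants (d i\<^sub>0) U \<subseteq> K"
    and \<zeta>: "\<zeta> \<in> U" "\<zeta> \<noteq> 0" "d i\<^sub>0 \<zeta> = r * \<zeta>" "r \<in> K"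
    and N_eq: "N = diff_gen I d (insert \<zeta> K)"
    and \<sigma>: "\<sigma> \<in> ring_hom (ring_on M) (ring_on M)" and \<tau>: "\<tau> \<in> ring_hom (ring_on N) (ring_on N)"
    and \<tau>_der: "\<And>a. a \<in> N \<Longrightarrow> \<tau> (d i\<^sub>0 a) = d i\<^sub>0 (\<tau> a)" and \<tau>_K: "\<And>a. a \<in> K \<Longrightarrow> \<tau> a = a"
    and agree: "\<And>a. a \<in> M \<inter> N \<Longrightarrow> \<sigma> a = \<tau> a"
    and rel: "paired_span \<sigma> \<tau> M N v w"
  shows "v = 0 \<longleftrightarrow> w = 0"
proof -
  let ?\<delta> = "d i\<^sub>0" and ?R = "M \<inter> N"
  interpret field_derivation U ?\<delta> by (rule field_derivation_diff_subfield[OF U o(1)])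
  have gen: "insert \<zeta> K \<subseteq> U" using \<zeta>(1) K(2) M(2) by auto
  have N: "diff_subfield I d N" "N \<subseteq> U" "K \<subseteq> N" "\<zeta> \<in> N"
    using diff_subfield_diff_gen[OF U gen] diff_gen_subset[OF U gen] diff_gen_superset[of "insert \<zeta> K" I d]
    by (auto simp: N_eq)
  have R: "diff_subfield I d ?R" by (rule diff_subfield_Int[OF M(1) N(1)])
  note M_field = diff_subfieldD(1)[OF M(1)] and N_field = diff_subfieldD(1)[OF N(1)]
  note M_sub = subfield_subring[OF M_field] and N_sub = subfield_subring[OF N_field]
    and R_sub = subfield_subring[OF diff_subfieldD(1)[OF R]]
  define Z where "Z = {z \<in> N. ?\<delta> z \<in> K}"
  have CM: "constants ?\<delta> U \<subseteq> M" using o(2) K(2) by simp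
  obtain B where B: "B \<subseteq> Z" "indep_mod (constants ?\<delta> U) M B"
    and Z_span: "\<And>z. z \<in> Z \<Longrightarrow> \<exists>B1 e. finite B1 \<and> B1 \<subseteq> B \<and> (\<forall>b\<in>B1. e b \<in> constants ?\<delta> U) \<and>
      z - (\<Sum>b\<in>B1. e b * b) \<in> M"
    using indep_mod_maximal[OF field_constants[OF U o(1)] CM M_field, of Z] by auto
  have BN: "B \<subseteq> N" using B(1) by (auto simp: Z_def)
  \<comment> \<open>powers of \<open>\<zeta>\<close> lie in \<open>N\<close>, so such a power is in \<open>M\<close> iff it is in \<open>R\<close>: spanning over \<open>R\<close> and independence over \<open>M\<close> use the same exponents\<close>
  have same: "monomials ?R \<zeta> B = monomials M \<zeta> B"
    using subring_set_closed(2)[OF N_sub N(4)] by (simp add: monomials_def)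
  define X where "X = monomial \<zeta> ` monomials M \<zeta> B"
  define A where "A = lin_span ?R X"
  have A: "subring_set A" "?R \<subseteq> A" "\<zeta> \<in> A" "B \<subseteq> A"
    using lin_span_monomials[where \<zeta> = \<zeta> and B = B, OF R_sub] unfolding same A_def X_def by auto
  have KA: "K \<subseteq> A" using A(2) K(2) N(3) by auto
  note A_ring = subring_setD[OF A(1)] subring_set_closed[OF A(1)]
  have X_in: "X \<subseteq> T" if "subring_set T" "\<zeta> \<in> T" "B \<subseteq> T" for T
    using that by (auto simp: X_def monomial_def monomials_def subset_iff
        intro!: subring_setD(5)[OF that(1)] subring_set_closed(2,5)[OF that(1)])
  have XN: "X \<subseteq> N" by (rule X_in[OF N_sub N(4) BN])
  have AN: "A \<subseteq> N" unfolding A_def by (rule lin_span_minimal[OF N_sub _ XN]) auto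
  have ZA: "Z \<subseteq> A"
  proof
    fix z assume z: "z \<in> Z"
    obtain B1 e where B1: "finite B1" "B1 \<subseteq> B" "\<And>b. b \<in> B1 \<Longrightarrow> e b \<in> K" "z - (\<Sum>b\<in>B1. e b * b) \<in> M"
      using Z_span[OF z] o(2) by blast
    have "(\<Sum>b\<in>B1. e b * b) \<in> N"
      using B1(2,3) BN N(3) by (intro subring_set_closed(4)[OF N_sub] subring_setD(5)[OF N_sub]) auto
    then have "z - (\<Sum>b\<in>B1. e b * b) \<in> A"
      using z B1(4) A(2) subring_set_closed(1)[OF N_sub] by (auto simp: Z_def)
    moreover have "(\<Sum>b\<in>B1. e b * b) \<in> A"
      using B1(2,3) A(4) KA by (intro A_ring) auto
    ultimately show "z \<in> A" using A_ring(4) by fastforce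
  qed
  \<comment> \<open>\<open>Z\<close> and hence \<open>A\<close> absorb all derivatives of \<open>\<zeta>\<close>, so \<open>A\<close> is closed under the derivations\<close>
  have log_der: "d i \<zeta> / \<zeta> \<in> Z" if i: "i \<in> I" for i
  proof -
    have r: "r \<in> U" using \<zeta>(4) K(2) M(2) by auto
    have "?\<delta> (d i \<zeta>) = d i (r * \<zeta>)" using diff_subfieldD(4)[OF U o(1) i \<zeta>(1)] \<zeta>(3) by simp
    also have "\<dots> = d i r * \<zeta> + r * d i \<zeta>"
      by (rule field_derivation.der_mult[OF field_derivation_diff_subfield[OF U i] r \<zeta>(1)])
    finally have "?\<delta> (d i \<zeta> / \<zeta>) = d i r"
      using der_divide[OF diff_subfieldD(3)[OF U i \<zeta>(1)] \<zeta>(1,2)] \<zeta>(2,3)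
      by (simp add: field_simps)
    then show ?thesis
      using diff_subfieldD(3)[OF K(1) i \<zeta>(4)] diff_subfieldD(3)[OF N(1) i N(4)] N(4)
      by (simp add: Z_def subfield_divide[OF N_field])
  qed
  have dZ: "d i z \<in> Z" if "i \<in> I" "z \<in> Z" for i z
  proof -
    have z: "z \<in> N" "?\<delta> z \<in> K" using that by (auto simp: Z_def)
    then have "?\<delta> (d i z) = d i (?\<delta> z)" using diff_subfieldD(4)[OF N(1) o(1) that(1)] by simp
    then show ?thesis
      using z diff_subfieldD(3)[OF K(1) that(1)] diff_subfieldD(3)[OF N(1) that(1)] by (simp add: Z_def)
  qed
  have dA: "d i a \<in> A" if i: "i \<in> I" and "a \<in> A" for i a
  proof -
    interpret di: field_derivation U "d i" by (rule field_derivation_diff_subfield[OF U i])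
    define W where "W = {a \<in> A. d i a \<in> A}"
    have inU: "a \<in> U" if "a \<in> A" for a using that AN N(2) by auto
    have W: "subring_set W"
      unfolding subring_set_def W_def
      by (auto simp: di.der_0 di.der_1 di.der_uminus di.der_add di.der_mult inU intro: A_ring)
    have RW: "?R \<subseteq> W" using A(2) diff_subfieldD(3)[OF R i] unfolding W_def by blast
    have "d i \<zeta> = d i \<zeta> / \<zeta> * \<zeta>" using \<zeta>(2) by simp
    also have "\<dots> \<in> A" using log_der[OF i] ZA A(3) by (intro A_ring) auto
    finally have \<zeta>W: "\<zeta> \<in> W" using A(3) by (simp add: W_def)
    have BW: "B \<subseteq> W" using A(4) B(1) ZA dZ[OF i] unfolding W_def by blast
    have "A \<subseteq> W"
      unfolding A_def by (rule lin_span_minimal[OF W RW X_in[OF W \<zeta>W BW]])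
    then show ?thesis using \<open>a \<in> A\<close> by (auto simp: W_def)
  qed
  have NA: "N \<subseteq> fractions A"
    unfolding N_eq
  proof (rule diff_gen_subset)
    have sub: "fractions A \<subseteq> U"
      using AN N(2) by (auto simp: fractions_def intro!: U_closed)
    show "diff_subfield I d (fractions A)"
    proof (rule diff_subfield_subset[OF U sub field_fractions[OF A(1)]])
      fix i u assume i: "i \<in> I" and "u \<in> fractions A"
      then obtain p q where pq: "p \<in> A" "q \<in> A" "q \<noteq> 0" "u = p / q" by (auto simp: fractions_def)
      then have "d i u = (d i p * q - p * d i q) / (q * q)"
        using AN N(2)
        by (auto intro!: field_derivation.der_divide[OF field_derivation_diff_subfield[OF U i]])
      also have "\<dots> \<in> fractions A"
        using pq dA[OF i] by (intro fractionsI A_ring) auto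
      finally show "d i u \<in> fractions A" .
    qed
    show "insert \<zeta> K \<subseteq> fractions A"
    proof
      fix a assume "a \<in> insert \<zeta> K"
      then have "a \<in> A" using A(2,3) K(2) N(3) by auto
      then show "a \<in> fractions A" using fractionsI[of a A 1] A_ring(2) by simp
    qed
  qed
  obtain D where D: "D \<in> A" "D \<noteq> 0" "paired_span \<sigma> \<tau> M A (v * D) (w * \<tau> D)"
    using paired_span_clear_denominators[OF \<sigma> \<tau> N_field A(1) AN NA rel] by blast
  have \<tau>D: "\<tau> D \<noteq> 0" using D AN by (intro ring_hom_on_nonzero[OF \<tau> N_field]) auto
  have "paired_span \<sigma> \<tau> M X (v * D) (w * \<tau> D)"
    using D(3) agree unfolding A_def
    by (intro paired_span_lin_span[OF \<sigma> M_sub \<tau> N_sub _ _ _ XN, where R = ?R]) auto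
  from paired_span_coordinates[OF \<sigma> M_sub this[unfolded X_def]]
  obtain J c where J: "finite J" "J \<subseteq> monomials M \<zeta> B" "\<forall>i. c i \<in> M" "\<forall>i. i \<notin> J \<longrightarrow> c i = 0"
    "v * D = (\<Sum>i\<in>J. c i * monomial \<zeta> i)" "w * \<tau> D = (\<Sum>i\<in>J. \<sigma> (c i) * \<tau> (monomial \<zeta> i))"
    by blast
  have BU: "B \<subseteq> U" using BN N(2) by simp
  have dB: "?\<delta> b \<in> K" if "b \<in> B" for b using that B(1) by (auto simp: Z_def)
  have dBM: "?\<delta> b \<in> M" if "b \<in> B" for b using dB[OF that] K(2) by auto
  have rM: "r \<in> M" using \<zeta>(4) K(2) by auto
  note dM = diff_subfieldD(3)[OF M(1) o(1)]
  have \<sigma>_zero: "\<sigma> a = 0 \<longleftrightarrow> a = 0" if "a \<in> M" for a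
    using that ring_hom_on_nonzero[OF \<sigma> M_field] ring_hom_on_0[OF \<sigma> M_sub] by blast
  have c_v: "\<forall>i. c i = 0" if "v = 0"
  proof
    show "c i = 0" for i
    proof (rule monomials_independent[where c = c, OF M_field M(2) dM CM \<zeta>(1-3) rM BU dBM B(2) J(1,2)])
      show "c i \<in> M" for i by (rule J(3)[rule_format])
      show "i \<notin> J \<Longrightarrow> c i = 0" for i by (rule J(4)[rule_format])
      show "(\<Sum>i\<in>J. c i * monomial \<zeta> i) = 0" using J(5) that by simp
    qed
  qed
  have c_w: "\<forall>i. c i = 0" if "w = 0"
  proof -
    have \<tau>N: "\<tau> a \<in> N" if "a \<in> N" for a using ring_hom_onD(1)[OF \<tau> that] .
    define e where "e = \<tau> \<zeta> / \<zeta>"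
    have "?\<delta> (\<tau> \<zeta>) = r * \<tau> \<zeta>"
      using \<tau>_der[OF N(4)] \<zeta>(3,4) N(3,4) \<tau>_K ring_hom_onD(4)[OF \<tau>, of r \<zeta>] by auto
    moreover have \<tau>\<zeta>: "\<tau> \<zeta> \<in> U" "\<tau> \<zeta> \<noteq> 0"
      using \<tau>N[OF N(4)] N(2) ring_hom_on_nonzero[OF \<tau> N_field N(4) \<zeta>(2)] by auto
    ultimately have e: "e \<in> constants ?\<delta> U" "e \<noteq> 0"
      using der_divide[OF \<tau>\<zeta>(1) \<zeta>(1,2)] \<zeta>(2,3) U_closed(12)[OF \<tau>\<zeta>(1) \<zeta>(1)]
      by (auto simp: e_def constants_def)
    have e\<zeta>: "e * \<zeta> = \<tau> \<zeta>" using \<zeta>(2) by (simp add: e_def)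
    have trans: "\<tau> b - b \<in> constants ?\<delta> U" if "b \<in> B" for b
    proof -
      have b: "b \<in> N" "\<tau> b \<in> U" "b \<in> U" using that BN N(2) \<tau>N by auto
      have "?\<delta> (\<tau> b) = ?\<delta> b" using \<tau>_der[OF b(1)] \<tau>_K[OF dB[OF that]] by simp
      then show ?thesis using b by (simp add: constants_def der_diff U_ring)
    qed
    have inj: "inj_on \<tau> B"
    proof (rule inj_onI)
      fix a b assume ab: "a \<in> B" "b \<in> B" "\<tau> a = \<tau> b"
      then have "a \<in> N" "b \<in> N" using BN by auto
      then have "\<tau> (a - b) = 0" "a - b \<in> N"
        using ring_hom_onD(3)[OF \<tau>, of a "- b"] ring_hom_on_uminus[OF \<tau> N_sub, of b] ab(3)
          subring_setD(3)[OF N_sub] subring_set_closed(1)[OF N_sub] by auto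
      then show "a = b" using ring_hom_on_nonzero[OF \<tau> N_field, of "a - b"] by auto
    qed
    have mono: "\<tau> (monomial \<zeta> i) = monomial (e * \<zeta>) (fst i, image_mset \<tau> (snd i))"
      if i: "i \<in> J" for i
    proof -
      have pow: "\<tau> (\<zeta> ^ k) = \<tau> \<zeta> ^ k" for k
        using N(4) by (induction k)
          (auto simp: ring_hom_onD(2,4)[OF \<tau>] subring_set_closed(2)[OF N_sub])
      have prod: "\<Prod>\<^sub># \<alpha> \<in> N \<and> \<tau> (\<Prod>\<^sub># \<alpha>) = \<Prod>\<^sub># (image_mset \<tau> \<alpha>)" if "set_mset \<alpha> \<subseteq> N" for \<alpha>
        using that by (induction \<alpha>) (auto simp: ring_hom_onD(2,4)[OF \<tau>] subring_setD[OF N_sub])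
      have "i \<in> monomials M \<zeta> B" using i J(2) by auto
      then have "set_mset (snd i) \<subseteq> N" using BN by (auto simp: monomials_def mem_Times_iff)
      then show ?thesis
        using prod[of "snd i"] N(4)
        by (simp add: monomial_def e\<zeta> pow ring_hom_onD(4)[OF \<tau>] subring_set_closed(2)[OF N_sub])
    qed
    have "\<sigma> (c i) = 0" for i
    proof (rule twisted_monomials_independent[where c = "\<lambda>i. \<sigma> (c i)", OF M_field M(2) dM field_constants[OF U o(1)] CM \<zeta>(1-3) rM
          BU dBM B(2) J(1,2) e inj trans])
      show "\<sigma> (c i) \<in> M" for i by (rule ring_hom_onD(1)[OF \<sigma> J(3)[rule_format]])
      show "\<sigma> (c i) = 0" if "i \<notin> J" for i
        by (simp only: J(4)[rule_format, OF that] ring_hom_on_0[OF \<sigma> M_sub])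
      show "(\<Sum>i\<in>J. \<sigma> (c i) * monomial (e * \<zeta>) (fst i, image_mset \<tau> (snd i))) = 0"
        using J(6) \<open>w = 0\<close> by (simp add: mono)
    qed
    then show ?thesis using \<sigma>_zero[OF J(3)[rule_format]] by simp
  qed
  have c_0: "v * D = 0 \<and> w * \<tau> D = 0" if "\<forall>i. c i = 0"
    by (simp only: J(5,6) that[rule_format] ring_hom_on_0[OF \<sigma> M_sub] mult_zero_left sum.neutral_const
        simp_thms)
  show ?thesis
  proof
    assume "v = 0"
    from c_0[OF c_v[OF this]] show "w = 0" using \<tau>D by simp
  next
    assume "w = 0"
    from c_0[OF c_w[OF this]] show "v = 0" using D(2) by simp
  qed
qed

section \<open>Differential automorphisms\<close>

lemma diff_aut_iff:
  "\<sigma> \<in> diff_aut I d M K \<longleftrightarrow> \<sigma> \<in> extensional M \<and> bij_betw \<sigma> M M \<and>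
     \<sigma> \<in> ring_hom (ring_on M) (ring_on M) \<and> (\<forall>i\<in>I. \<forall>a\<in>M. \<sigma> (d i a) = d i (\<sigma> a)) \<and> (\<forall>a\<in>K. \<sigma> a = a)"
  by (auto simp: diff_aut_def Bij_def ring_iso_def)

lemma diff_autD:
  assumes "\<sigma> \<in> diff_aut I d M K"
  shows "\<sigma> \<in> extensional M" "bij_betw \<sigma> M M" "\<sigma> \<in> ring_hom (ring_on M) (ring_on M)"
    "i \<in> I \<Longrightarrow> a \<in> M \<Longrightarrow> \<sigma> (d i a) = d i (\<sigma> a)" "a \<in> K \<Longrightarrow> \<sigma> a = a" "a \<in> M \<Longrightarrow> \<sigma> a \<in> M"
  using assms by (auto simp: diff_aut_iff dest: bij_betwE)

lemma carrier_Gal [simp]: "carrier (Gal I d L K) = diff_aut I d L K"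
  by (simp add: Gal_def)

lemma mult_Gal:
  "\<sigma> \<in> diff_aut I d L K \<Longrightarrow> \<tau> \<in> diff_aut I d L K \<Longrightarrow> \<sigma> \<otimes>\<^bsub>Gal I d L K\<^esub> \<tau> = compose L \<sigma> \<tau>"
  by (simp add: Gal_def BijGroup_def diff_aut_def)

text \<open>
  The elements of \<open>L\<close> with image in \<open>L\<close> form a differential field containing the generators.
\<close>
lemma diff_aut_generators_stable:
  assumes U: "diff_subfield I d U" and \<gamma>: "\<gamma> \<in> diff_aut I d U K"
    and L_eq: "L = diff_gen I d A" and A: "A \<subseteq> U" "\<gamma> ` A \<subseteq> L"
  shows "\<gamma> ` L \<subseteq> L"
proof -
  have L: "diff_subfield I d L" and LU: "L \<subseteq> U"
    unfolding L_eq by (rule diff_subfield_diff_gen[OF U A(1)], rule diff_gen_subset[OF U A(1)])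
  note g = diff_autD[OF \<gamma>] and cl = diff_subfield_closed[OF L]
  have inU: "a \<in> U" if "a \<in> L" for a using that LU by auto
  define P where "P = {a \<in> L. \<gamma> a \<in> L}"
  have "diff_subfield I d P"
  proof (rule diff_subfield_subset[OF L])
    show "field (ring_on P)"
      unfolding field_ring_on_iff subring_set_def P_def
      using ring_hom_on_0[OF g(3) subfield_subring[OF diff_subfieldD(1)[OF U]]]
        ring_hom_on_uminus[OF g(3) subfield_subring[OF diff_subfieldD(1)[OF U]] inU]
        ring_hom_onD[OF g(3)] ring_hom_on_inverse[OF g(3) diff_subfieldD(1)[OF U] inU] inU
      by (auto intro: cl)
  qed (auto simp: P_def g(4) inU intro: cl)
  moreover have "A \<subseteq> P" using A(2) diff_gen_superset[of A I d] by (auto simp: P_def L_eq)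
  ultimately have "L \<subseteq> P" unfolding L_eq by (rule diff_gen_subset)
  then show ?thesis by (auto simp: P_def)
qed

lemma diff_subfield_equalizer:
  assumes U: "diff_subfield I d U" and \<gamma>: "\<gamma> \<in> diff_aut I d U K" "\<gamma>' \<in> diff_aut I d U K"
  shows "diff_subfield I d {a \<in> U. \<gamma> a = \<gamma>' a}"
proof (rule diff_subfield_subset[OF U])
  note cl = diff_subfield_closed[OF U] and g = diff_autD[OF \<gamma>(1)] and g' = diff_autD[OF \<gamma>(2)]
  note U_field = diff_subfieldD(1)[OF U]
  note homs = ring_hom_on_0[OF _ subfield_subring[OF U_field]] ring_hom_on_uminus[OF _ subfield_subring[OF U_field]]
    ring_hom_onD(2-4) ring_hom_on_inverse[OF _ U_field]
  show "field (ring_on {a \<in> U. \<gamma> a = \<gamma>' a})"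
    unfolding field_ring_on_iff subring_set_def
    by (auto simp: homs[OF g(3)] homs[OF g'(3)] intro: cl)
  show "d i a \<in> {a \<in> U. \<gamma> a = \<gamma>' a}" if "i \<in> I" "a \<in> {a \<in> U. \<gamma> a = \<gamma>' a}" for i a
    using that g(4)[OF that(1)] g'(4)[OF that(1)] by (auto intro: cl)
qed auto

text \<open>
  Stability under all automorphisms, in particular under \<open>\<gamma>\<close> and its inverse, upgrades the inclusion
  \<open>\<gamma> ` L \<subseteq> L\<close> to an equality.
\<close>
lemma diff_aut_restrict:
  assumes U: "diff_subfield I d U" and L: "diff_subfield I d L" "K \<subseteq> L" "L \<subseteq> U"
    and stable: "\<And>\<gamma>. \<gamma> \<in> diff_aut I d U K \<Longrightarrow> \<gamma> ` L \<subseteq> L" and \<gamma>: "\<gamma> \<in> diff_aut I d U K"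
  shows "restrict \<gamma> L \<in> diff_aut I d L K"
proof -
  have KU: "K \<subseteq> U" using L by simp
  interpret G: group "Gal I d U K" by (rule group_Gal[OF U KU])
  let ?\<gamma>' = "inv\<^bsub>Gal I d U K\<^esub> \<gamma>"
  have \<gamma>': "?\<gamma>' \<in> diff_aut I d U K" using G.inv_closed[of \<gamma>] \<gamma> by simp
  have "compose U \<gamma> ?\<gamma>' = (\<lambda>x\<in>U. x)"
    using G.r_inv[of \<gamma>] \<gamma> \<gamma>' mult_Gal[OF \<gamma> \<gamma>'] by (simp add: Gal_def BijGroup_def)
  then have "\<gamma> (?\<gamma>' a) = a" if "a \<in> U" for a
    using that by (metis compose_eq restrict_apply')
  then have "L \<subseteq> \<gamma> ` L" using stable[OF \<gamma>'] L(3) by (metis image_eqI image_subset_iff subset_iff)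
  then have "\<gamma> ` L = L" using stable[OF \<gamma>] by auto
  then have "bij_betw (restrict \<gamma> L) L L"
    using diff_autD(2)[OF \<gamma>] L(3) by (auto simp: bij_betw_def intro: inj_on_subset)
  then show ?thesis
    using diff_autD(3-5)[OF \<gamma>] L stable[OF \<gamma>] diff_subfield_closed[OF L(1)]
    by (auto simp: diff_aut_iff ring_hom_def subset_iff)
qed

section \<open>Gluing compatible automorphisms\<close>

text \<open>
  The relation \<open>Q\<close> of fractions of paired sums is compatible with the field operations and the
  derivations, and by faithfulness it is single-valued in both directions.  Its domain and range
  are differential fields containing \<open>M\<close> and \<open>N\<close>, hence equal to \<open>U\<close>; so it is the graph of an
  automorphism.
\<close>
lemma diff_aut_glue:
  fixes d :: "'i \<Rightarrow> 'a::field_char_0 \<Rightarrow> 'a"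
  assumes U: "diff_subfield I d U" and M: "diff_subfield I d M" "M \<subseteq> U" and N: "diff_subfield I d N" "N \<subseteq> U"
    and gen: "\<And>T. diff_subfield I d T \<Longrightarrow> M \<subseteq> T \<Longrightarrow> N \<subseteq> T \<Longrightarrow> U \<subseteq> T"
    and \<sigma>: "\<sigma> \<in> diff_aut I d M K" and \<tau>: "\<tau> \<in> diff_aut I d N K" and K: "K \<subseteq> M"
    and faithful: "\<And>v w. paired_span \<sigma> \<tau> M N v w \<Longrightarrow> v = 0 \<longleftrightarrow> w = 0"
  shows "\<exists>\<gamma>\<in>diff_aut I d U K. restrict \<gamma> M = \<sigma> \<and> restrict \<gamma> N = \<tau>"
proof -
  note s = diff_autD[OF \<sigma>] and t = diff_autD[OF \<tau>]
  note U_cl = diff_subfield_closed[OF U] and M_cl = diff_subfield_closed[OF M(1)]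
    and N_cl = diff_subfield_closed[OF N(1)]
  have M_sub: "subring_set M" and N_sub: "subring_set N"
    by (rule subfield_subring[OF diff_subfieldD(1)[OF M(1)]], rule subfield_subring[OF diff_subfieldD(1)[OF N(1)]])
  let ?G = "paired_span \<sigma> \<tau> M N"
  note G_mult = paired_span_mult[OF s(3) M_sub t(3) N_sub order_refl]
  note G_add = paired_span_add[of \<sigma> \<tau> M N] and G_uminus = paired_span_uminus[OF s(3) M_sub]
  have G_M: "?G a (\<sigma> a)" if "a \<in> M" for a
    using paired_span_base[OF that N_cl(2), of \<sigma> \<tau>] ring_hom_onD(2)[OF t(3)] by simp
  have G_N: "?G a (\<tau> a)" if "a \<in> N" for a
    using paired_span_base[OF M_cl(2) that, of \<sigma> \<tau>] ring_hom_onD(2)[OF s(3)] by simp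
  have G_U: "a \<in> U \<and> b \<in> U" if "?G a b" for a b
    using that by induction (use s(6) t(6) M(2) N(2) in \<open>auto intro!: U_cl(1,4,5)\<close>)
  have G_der: "?G (d i a) (d i b)" if i: "i \<in> I" and "?G a b" for i a b
  proof -
    interpret field_derivation U "d i" by (rule field_derivation_diff_subfield[OF U i])
    show ?thesis
      using \<open>?G a b\<close>
    proof induction
      case (paired_span_add_term m n a b)
      have "m \<in> U" "n \<in> U" "\<sigma> m \<in> U" "\<tau> n \<in> U" "a \<in> U" "b \<in> U"
        using paired_span_add_term s(6) t(6) M(2) N(2) G_U by auto
      then have "d i (m * n + a) = d i m * n + (m * d i n + d i a)"
        "d i (\<sigma> m * \<tau> n + b) = \<sigma> (d i m) * \<tau> n + (\<sigma> m * \<tau> (d i n) + d i b)"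
        using paired_span_add_term(1,2) i by (simp_all add: der_add der_mult U_cl s(4) t(4))
      then show ?case
        using paired_span_add_term i M_cl N_cl
        by (simp only:) (intro paired_span.paired_span_add_term; simp)
    qed (simp add: der_0 paired_span_0)
  qed
  define Q where "Q u w \<longleftrightarrow> (\<exists>a b a' b'. ?G a b \<and> ?G a' b' \<and> a' \<noteq> 0 \<and> u = a / a' \<and> w = b / b')" for u w
  have QE: "\<exists>a b a' b'. ?G a b \<and> ?G a' b' \<and> a' \<noteq> 0 \<and> b' \<noteq> 0 \<and> u = a / a' \<and> w = b / b'" if "Q u w" for u w
    using that faithful unfolding Q_def by blast
  have QI: "Q (a / a') (b / b')" if "?G a b" "?G a' b'" "a' \<noteq> 0" for a b a' b'
    using that unfolding Q_def by blast
  have Q_G: "Q a b" if "?G a b" for a b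
    using QI[OF that G_M[OF M_cl(2)]] ring_hom_onD(2)[OF s(3)] by simp
  \<comment> \<open>cross-multiplication reduces equality of fractions to the vanishing of one paired sum\<close>
  have Q_eq: "u = u' \<longleftrightarrow> w = w'" if uw: "Q u w" "Q u' w'" for u w u' w'
  proof -
    obtain a b a' b' where 1: "?G a b" "?G a' b'" "a' \<noteq> 0" "b' \<noteq> 0" "u = a / a'" "w = b / b'"
      using QE[OF uw(1)] by blast
    obtain e f e' f' where 2: "?G e f" "?G e' f'" "e' \<noteq> 0" "f' \<noteq> 0" "u' = e / e'" "w' = f / f'"
      using QE[OF uw(2)] by blast
    have "?G (a * e' + - (e * a')) (b * f' + - (f * b'))"
      by (intro G_add G_uminus G_mult 1 2)
    from faithful[OF this] show ?thesis using 1 2 by (simp add: frac_eq_eq)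
  qed
  have Q_add: "Q (u + u') (w + w')" and Q_mult: "Q (u * u') (w * w')"
    if uw: "Q u w" "Q u' w'" for u w u' w'
  proof -
    obtain a b a' b' where 1: "?G a b" "?G a' b'" "a' \<noteq> 0" "b' \<noteq> 0" "u = a / a'" "w = b / b'"
      using QE[OF uw(1)] by blast
    obtain e f e' f' where 2: "?G e f" "?G e' f'" "e' \<noteq> 0" "f' \<noteq> 0" "u' = e / e'" "w' = f / f'"
      using QE[OF uw(2)] by blast
    have "Q ((a * e' + e * a') / (a' * e')) ((b * f' + f * b') / (b' * f'))"
      "Q ((a * e) / (a' * e')) ((b * f) / (b' * f'))"
      by (intro QI G_add G_mult 1 2; use 1 2 in simp)+
    then show "Q (u + u') (w + w')" "Q (u * u') (w * w')" using 1 2 by (simp_all add: add_frac_eq)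
  qed
  have Q_uminus: "Q (- u) (- w)" if "Q u w" for u w
  proof -
    have "?G (- 1) (- \<sigma> 1)" by (intro G_uminus G_M M_cl)
    from Q_mult[OF Q_G[OF this] that] show ?thesis by (simp add: ring_hom_onD(2)[OF s(3)])
  qed
  have Q_inverse: "Q (inverse u) (inverse w)" if uw: "Q u w" for u w
  proof -
    obtain a b a' b' where 1: "?G a b" "?G a' b'" "a' \<noteq> 0" "b' \<noteq> 0" "u = a / a'" "w = b / b'"
      using QE[OF uw] by blast
    show ?thesis
    proof (cases "a = 0")
      case True
      then show ?thesis using faithful[OF 1(1)] 1(5,6) uw by simp
    next
      case False
      then show ?thesis using QI[OF 1(2,1)] 1(5,6) by (simp add: field_simps)
    qed
  qed
  have Q_U: "u \<in> U \<and> w \<in> U" if "Q u w" for u w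
    using QE[OF that] G_U by (auto intro: U_cl(7))
  have Q_der: "Q (d i u) (d i w)" if i: "i \<in> I" and uw: "Q u w" for i u w
  proof -
    interpret field_derivation U "d i" by (rule field_derivation_diff_subfield[OF U i])
    obtain a b a' b' where 1: "?G a b" "?G a' b'" "a' \<noteq> 0" "b' \<noteq> 0" "u = a / a'" "w = b / b'"
      using QE[OF uw] by blast
    have "Q ((d i a * a' + - (a * d i a')) / (a' * a')) ((d i b * b' + - (b * d i b')) / (b' * b'))"
      using 1(3) by (intro QI G_add G_uminus G_mult G_der 1 i) simp
    then show ?thesis using 1 G_U by (simp add: der_divide)
  qed
  have Q_01: "Q 0 0" "Q 1 1"
    using Q_G[OF paired_span_0] Q_G[OF G_M[OF M_cl(2)]] ring_hom_onD(2)[OF s(3)] by simp_all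
  have dom: "\<exists>w. Q u w" if "u \<in> U" for u
  proof -
    have "U \<subseteq> {u. \<exists>w. Q u w}"
    proof (rule gen)
      show "diff_subfield I d {u. \<exists>w. Q u w}"
      proof (rule diff_subfield_subset[OF U])
        show "field (ring_on {u. \<exists>w. Q u w})"
          unfolding field_ring_on_iff subring_set_def
          using Q_01 Q_uminus Q_inverse Q_add Q_mult by simp metis
      qed (use Q_U Q_der in blast)+
    qed (use Q_G G_M G_N in blast)+
    then show ?thesis using that by auto
  qed
  have ran: "\<exists>u. Q u w" if "w \<in> U" for w
  proof -
    have "U \<subseteq> {w. \<exists>u. Q u w}"
    proof (rule gen)
      show "diff_subfield I d {w. \<exists>u. Q u w}"
      proof (rule diff_subfield_subset[OF U])
        show "field (ring_on {w. \<exists>u. Q u w})"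
          unfolding field_ring_on_iff subring_set_def
          using Q_01 Q_uminus Q_inverse Q_add Q_mult by simp metis
      qed (use Q_U Q_der in blast)+
      show "M \<subseteq> {w. \<exists>u. Q u w}"
      proof
        fix w assume "w \<in> M"
        then obtain a where "a \<in> M" "w = \<sigma> a" using s(2) by (auto simp: bij_betw_def)
        then show "w \<in> {w. \<exists>u. Q u w}" using Q_G G_M by blast
      qed
      show "N \<subseteq> {w. \<exists>u. Q u w}"
      proof
        fix w assume "w \<in> N"
        then obtain a where "a \<in> N" "w = \<tau> a" using t(2) by (auto simp: bij_betw_def)
        then show "w \<in> {w. \<exists>u. Q u w}" using Q_G G_N by blast
      qed
    qed
    then show ?thesis using that by auto
  qed
  define \<gamma> where "\<gamma> = (\<lambda>u\<in>U. THE w. Q u w)"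
  have \<gamma>_eq: "\<gamma> u = w" if "Q u w" for u w
  proof -
    have "(THE w. Q u w) = w" using that Q_eq by (intro the_equality) blast+
    then show ?thesis using Q_U[OF that] by (simp add: \<gamma>_def)
  qed
  have Q_\<gamma>: "Q u (\<gamma> u)" if "u \<in> U" for u
    using dom[OF that] \<gamma>_eq by auto
  have \<gamma>_M: "\<gamma> a = \<sigma> a" if "a \<in> M" for a by (rule \<gamma>_eq[OF Q_G[OF G_M[OF that]]])
  have \<gamma>_N: "\<gamma> a = \<tau> a" if "a \<in> N" for a by (rule \<gamma>_eq[OF Q_G[OF G_N[OF that]]])
  have "\<gamma> \<in> diff_aut I d U K"
    unfolding diff_aut_iff
  proof (intro conjI ballI)
    show "\<gamma> \<in> extensional U" by (simp add: \<gamma>_def)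
    show "bij_betw \<gamma> U U"
    proof (rule bij_betw_imageI)
      show "inj_on \<gamma> U"
        by (rule inj_onI) (use Q_eq[OF Q_\<gamma> Q_\<gamma>] in auto)
      show "\<gamma> ` U = U"
      proof
        show "\<gamma> ` U \<subseteq> U" using Q_U Q_\<gamma> by blast
        show "U \<subseteq> \<gamma> ` U"
        proof
          fix w assume "w \<in> U"
          then obtain u where "Q u w" using ran by blast
          then show "w \<in> \<gamma> ` U" using \<gamma>_eq[of u w] Q_U[of u w] by force
        qed
      qed
    qed
    show "\<gamma> \<in> ring_hom (ring_on U) (ring_on U)"
      using Q_U Q_\<gamma> \<gamma>_eq[OF Q_add[OF Q_\<gamma> Q_\<gamma>]] \<gamma>_eq[OF Q_mult[OF Q_\<gamma> Q_\<gamma>]] \<gamma>_eq[OF Q_01(2)]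
      by (auto simp: ring_hom_def)
    show "\<gamma> (d i a) = d i (\<gamma> a)" if "i \<in> I" "a \<in> U" for i a
      by (rule \<gamma>_eq[OF Q_der[OF that(1) Q_\<gamma>[OF that(2)]]])
    show "\<gamma> a = a" if "a \<in> K" for a using \<gamma>_M s(5)[OF that] that K by auto
  qed
  moreover have "restrict \<gamma> M = \<sigma>" "restrict \<gamma> N = \<tau>"
    using \<gamma>_M \<gamma>_N by (auto intro!: extensionalityI[OF _ s(1)] extensionalityI[OF _ t(1)])
  ultimately show ?thesis by blast
qed

section \<open>Solutions of first- and second-order linear equations\<close>

lemma (in field_derivation) quotient_of_solutions:
  assumes "y \<in> U" "\<delta> y = r * y" "z \<in> U" "\<delta> z = r * z" "z \<noteq> 0"
  shows "y / z \<in> constants \<delta> U"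
  using assms der_divide[of y z] U_closed(12)[of y z] by (simp add: constants_def)

text \<open>
  Wronskians of solutions are constants because the equation has no first-order term, and Cramer's
  rule expresses \<open>u\<close> by them.  The Wronskian of \<open>y\<close> and \<open>z\<close> is nonzero: otherwise \<open>z / y\<close> would be a
  constant.
\<close>
lemma (in field_derivation) second_order_solution_span:
  assumes y: "y \<in> U" "\<delta> (\<delta> y) = q * y" and z: "z \<in> U" "\<delta> (\<delta> z) = q * z"
    and u: "u \<in> U" "\<delta> (\<delta> u) = q * u"
    and indep: "\<And>a b. a \<in> constants \<delta> U \<Longrightarrow> b \<in> constants \<delta> U \<Longrightarrow> a * y + b * z = 0 \<Longrightarrow> a = 0 \<and> b = 0"
  shows "\<exists>a\<in>constants \<delta> U. \<exists>b\<in>constants \<delta> U. u = a * y + b * z"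
proof -
  define W where "W f g = f * \<delta> g - \<delta> f * g" for f g
  have W: "W f g \<in> U" "\<delta> (W f g) = 0"
    if "f \<in> U" "\<delta> (\<delta> f) = q * f" "g \<in> U" "\<delta> (\<delta> g) = q * g" for f g
    using that by (simp_all add: W_def der_diff der_mult der_in U_ring)
  have const_0: "0 \<in> constants \<delta> U" and const_1: "1 \<in> constants \<delta> U"
    using der_0 der_1 U_ring(1,2) by (simp_all add: constants_def)
  have y0: "y \<noteq> 0"
    using indep[OF const_1 const_0] by auto
  have W0: "W y z \<noteq> 0"
  proof
    assume "W y z = 0"
    then have "\<delta> (z / y) = 0"
      using der_divide[OF z(1) y(1) y0] by (simp add: W_def mult.commute)
    then have c: "z / y \<in> constants \<delta> U" using U_closed(12)[OF z(1) y(1)] by (simp add: constants_def)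
    then have "- (z / y) \<in> constants \<delta> U"
      by (simp add: constants_def U_ring der_uminus)
    from indep[OF this const_1] show False using y0 by simp
  qed
  have div: "W f g / W y z \<in> constants \<delta> U"
    if "f \<in> U" "\<delta> (\<delta> f) = q * f" "g \<in> U" "\<delta> (\<delta> g) = q * g" for f g
    using W[OF that] W[OF y z] W0 der_divide[OF W(1)[OF that] W(1)[OF y z] W0]
    by (simp add: constants_def U_closed(12))
  have "u * W y z = W u z * y + W y u * z" by (simp add: W_def algebra_simps)
  then have "u = W u z / W y z * y + W y u / W y z * z" using W0 by (simp add: field_simps)
  then show ?thesis using div[OF u z] div[OF y u] by blast
qed

lemma lin_op_first_order: "lin_op \<delta> [:- r, 1:] y = \<delta> y - r * y"
  by (simp add: lin_op_def atMost_Suc numeral_2_eq_2)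

lemma lin_op_second_order: "lin_op \<delta> [:- q, 0, 1:] y = \<delta> (\<delta> y) - q * y"
  by (simp add: lin_op_def atMost_Suc numeral_2_eq_2)

lemma lin_indep_pair:
  assumes "lin_indep C [y, z]" "a \<in> C" "b \<in> C" "a * y + b * z = 0"
  shows "a = 0 \<and> b = 0"
proof -
  let ?c = "\<lambda>i::nat. if i = 0 then a else b"
  have "(\<forall>i<length [y, z]. ?c i \<in> C) \<and> (\<Sum>i<length [y, z]. ?c i * [y, z] ! i) = 0"
    using assms(2-4) by (simp add: lessThan_Suc add.commute)
  with spec[OF assms(1)[unfolded lin_indep_def], of ?c] have "\<forall>i<length [y, z]. ?c i = 0" ..
  from spec[OF this, of 0] spec[OF this, of 1] show ?thesis by simp
qed

lemma is_PPV_first_orderE: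
  assumes "is_PPV m d M U [:- r, 1:]"
  obtains y where "y \<in> U" "d 0 y = r * y" "U = diff_gen {0..m} d (insert y M)"
proof -
  obtain ys where ys: "length ys = Suc 0" "set ys \<subseteq> solutions (d 0) [:- r, 1:] U"
    "U = diff_gen {0..m} d (M \<union> set ys)"
    using assms by (auto simp: is_PPV_def)
  then obtain y where "ys = [y]" by (auto simp: length_Suc_conv)
  with ys show ?thesis by (intro that[of y]) (auto simp: solutions_def lin_op_first_order)
qed

lemma is_PPV_second_orderE:
  assumes "is_PPV m d K M [:- q, 0, 1:]"
  obtains y z where "y \<in> M" "d 0 (d 0 y) = q * y" "z \<in> M" "d 0 (d 0 z) = q * z"
    "lin_indep (constants (d 0) K) [y, z]" "M = diff_gen {0..m} d (K \<union> {y, z})"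
proof -
  obtain ys where ys: "length ys = Suc (Suc 0)" "set ys \<subseteq> solutions (d 0) [:- q, 0, 1:] M"
    "lin_indep (constants (d 0) K) ys" "M = diff_gen {0..m} d (K \<union> set ys)"
    using assms by (auto simp: is_PPV_def)
  then obtain y z where "ys = [y, z]" by (auto simp: length_Suc_conv)
  with ys show ?thesis by (intro that[of y z]) (auto simp: solutions_def lin_op_second_order)
qed

section \<open>The Galois group as a fibre product\<close>

theorem proposition3p3:
  fixes m :: nat
    and d :: "nat \<Rightarrow> 'a::field_char_0 \<Rightarrow> 'a"
    and F K M N R U :: "'a set"
    and x r\<^sub>1 r\<^sub>0 q \<eta> \<xi> \<zeta> :: 'a
    and \<Gamma> H D :: "('a \<Rightarrow> 'a) monoid"
  assumes F_closed: "diff_closed {1..m} (ring_on F) d"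
    and K_diff_field: "diff_subfield {0..m} d K"
    and K_gen: "K = field_gen (insert x F)"
    and K_constants: "constants (d 0) K = F"
    and d_x: "d 0 x = 1" "\<And>j. j \<in> {1..m} \<Longrightarrow> d j x = 0"
    and r_in_K: "r\<^sub>1 \<in> K" "r\<^sub>0 \<in> K"
    and q_eq: "q = r\<^sub>1\<^sup>2 - d 0 r\<^sub>1 - r\<^sub>0"
    and M_PPV: "is_PPV m d K M [:- q, 0, 1:]"
    and basis_indep: "lin_indep F [\<eta>, \<xi>]"
    and basis_span: "solutions (d 0) [:- q, 0, 1:] M = {a * \<eta> + b * \<xi> |a b. a \<in> F \<and> b \<in> F}"
    and U_PPV: "is_PPV m d M U [:- r\<^sub>1, 1:]"
    and zeta: "\<zeta> \<in> U" "\<zeta> \<noteq> 0" "d 0 \<zeta> = r\<^sub>1 * \<zeta>"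
    and N_eq: "N = diff_gen {0..m} d (insert \<zeta> K)"
    and R_eq: "R = M \<inter> N"
    and H_eq: "H = Gal {0..m} d M K"
    and D_eq: "D = Gal {0..m} d N K"
    and Gamma_eq: "\<Gamma> = Gal {0..m} d U K"
  shows "(\<lambda>\<gamma>. (restrict \<gamma> M, restrict \<gamma> N)) \<in> iso \<Gamma> (fibre_product H D R)"
proof -
  let ?I = "{0..m}"
  have o: "0 \<in> ?I" by simp
  have M: "diff_subfield ?I d M" and U: "diff_subfield ?I d U" and KM: "K \<subseteq> M" and MU: "M \<subseteq> U"
    and const: "constants (d 0) U = constants (d 0) K"
    using M_PPV U_PPV by (auto simp: is_PPV_def)
  have constK: "constants (d 0) U \<subseteq> K" unfolding const by (auto simp: constants_def)
  have KU: "K \<subseteq> U" and gens: "insert \<zeta> K \<subseteq> U" using KM MU zeta(1) by auto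
  have N: "diff_subfield ?I d N" "N \<subseteq> U" "K \<subseteq> N" "\<zeta> \<in> N"
    using diff_subfield_diff_gen[OF U gens] diff_gen_subset[OF U gens] diff_gen_superset[of "insert \<zeta> K" ?I d]
    by (auto simp: N_eq)
  interpret field_derivation U "d 0" by (rule field_derivation_diff_subfield[OF U o])
  \<comment> \<open>differential fields containing \<open>M\<close> and \<open>N\<close> contain the generator of \<open>U\<close> over \<open>M\<close>, a constant multiple of \<open>\<zeta>\<close>\<close>
  have gen: "U \<subseteq> T" if T: "diff_subfield ?I d T" "M \<subseteq> T" "N \<subseteq> T" for T
  proof -
    obtain y where y: "y \<in> U" "d 0 y = r\<^sub>1 * y" "U = diff_gen ?I d (insert y M)"
      by (rule is_PPV_first_orderE[OF U_PPV])
    have "y / \<zeta> \<in> T"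
      using quotient_of_solutions[OF y(1,2) zeta(1,3,2)] constK KM T(2) by auto
    then have "y / \<zeta> * \<zeta> \<in> T"
      using N(4) T(3) by (intro diff_subfield_closed(5)[OF T(1)]) auto
    then have "insert y M \<subseteq> T" using zeta(2) T(2) by simp
    then show ?thesis unfolding y(3) by (rule diff_gen_subset[OF T(1)])
  qed
  have stable_M: "\<gamma> ` M \<subseteq> M" if \<gamma>: "\<gamma> \<in> diff_aut ?I d U K" for \<gamma>
  proof -
    note g = diff_autD[OF \<gamma>]
    obtain y z where yz: "y \<in> M" "d 0 (d 0 y) = q * y" "z \<in> M" "d 0 (d 0 z) = q * z"
      "lin_indep (constants (d 0) K) [y, z]" and M_gen: "M = diff_gen ?I d (K \<union> {y, z})"
      by (rule is_PPV_second_orderE[OF M_PPV])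
    note M_cl = diff_subfield_closed[OF M]
    have yzU: "y \<in> U" "z \<in> U" using yz MU by auto
    have qK: "q \<in> K"
    proof -
      have "r\<^sub>1 * r\<^sub>1 + - d 0 r\<^sub>1 + - r\<^sub>0 \<in> K"
        using r_in_K by (intro diff_subfield_closed[OF K_diff_field] o)
      then show ?thesis by (simp add: q_eq power2_eq_square)
    qed
    have sol: "\<gamma> u \<in> M" if u: "u \<in> U" "d 0 (d 0 u) = q * u" for u
    proof -
      have "d 0 (d 0 (\<gamma> u)) = \<gamma> (q * u)"
        using u g(4)[OF o u(1)] g(4)[OF o der_in[OF u(1)]] by simp
      also have "\<dots> = q * \<gamma> u"
        using ring_hom_onD(4)[OF g(3)] qK KU u(1) g(5) by auto
      finally obtain a b where "a \<in> constants (d 0) U" "b \<in> constants (d 0) U" "\<gamma> u = a * y + b * z"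
        using second_order_solution_span[OF yzU(1) yz(2) yzU(2) yz(4) g(6)[OF u(1)]]
          lin_indep_pair[OF yz(5)] const by blast
      then show ?thesis using constK KM yz by (auto intro!: M_cl(4,5))
    qed
    have "\<gamma> ` (K \<union> {y, z}) \<subseteq> M"
      using sol[OF yzU(1) yz(2)] sol[OF yzU(2) yz(4)] g(5) KM by auto
    then show ?thesis
      using KU yzU by (intro diff_aut_generators_stable[OF U \<gamma> M_gen]) auto
  qed
  have stable_N: "\<gamma> ` N \<subseteq> N" if \<gamma>: "\<gamma> \<in> diff_aut ?I d U K" for \<gamma>
  proof -
    note g = diff_autD[OF \<gamma>]
    have "d 0 (\<gamma> \<zeta>) = \<gamma> (r\<^sub>1 * \<zeta>)" using g(4)[OF o zeta(1)] zeta(3) by simp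
    also have "\<dots> = r\<^sub>1 * \<gamma> \<zeta>" using ring_hom_onD(4)[OF g(3)] r_in_K(1) KU zeta(1) g(5) by auto
    finally have "\<gamma> \<zeta> / \<zeta> \<in> N"
      using quotient_of_solutions[OF g(6)[OF zeta(1)] _ zeta(1,3,2)] constK N(3) by auto
    then have "\<gamma> \<zeta> / \<zeta> * \<zeta> \<in> N" using N(4) by (rule diff_subfield_closed(5)[OF N(1)])
    then have "\<gamma> ` insert \<zeta> K \<subseteq> N" using g(5) N(3) zeta(2) by auto
    then show ?thesis
      by (rule diff_aut_generators_stable[OF U \<gamma> N_eq gens])
  qed
  note res_M = diff_aut_restrict[OF U M KM MU stable_M]
    and res_N = diff_aut_restrict[OF U N(1,3,2) stable_N]
  have RM: "R \<subseteq> M" and RN: "R \<subseteq> N" by (auto simp: R_eq)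
  have carrier_fp: "carrier (fibre_product H D R) =
      {(\<sigma>, \<tau>). \<sigma> \<in> diff_aut ?I d M K \<and> \<tau> \<in> diff_aut ?I d N K \<and> restrict \<sigma> R = restrict \<tau> R}"
    by (auto simp: fibre_product_def H_eq D_eq)
  have comp: "restrict (compose U \<gamma> \<gamma>') L = compose L (restrict \<gamma> L) (restrict \<gamma>' L)"
    if "\<gamma>' ` L \<subseteq> L" "L \<subseteq> U" for L and \<gamma> \<gamma>' :: "'a \<Rightarrow> 'a"
    using that by (auto simp: compose_def fun_eq_iff)
  show ?thesis
  proof (rule isoI)
    show hom: "(\<lambda>\<gamma>. (restrict \<gamma> M, restrict \<gamma> N)) \<in> hom \<Gamma> (fibre_product H D R)"
    proof (rule homI)
      fix \<gamma> assume "\<gamma> \<in> carrier \<Gamma>"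
      then have "\<gamma> \<in> diff_aut ?I d U K" by (simp add: Gamma_eq)
      then show "(restrict \<gamma> M, restrict \<gamma> N) \<in> carrier (fibre_product H D R)"
        using res_M res_N RM RN by (simp add: carrier_fp Int_absorb1 Int_absorb2)
    next
      fix \<gamma> \<gamma>' assume "\<gamma> \<in> carrier \<Gamma>" "\<gamma>' \<in> carrier \<Gamma>"
      then have g: "\<gamma> \<in> diff_aut ?I d U K" "\<gamma>' \<in> diff_aut ?I d U K" by (simp_all add: Gamma_eq)
      show "(restrict (\<gamma> \<otimes>\<^bsub>\<Gamma>\<^esub> \<gamma>') M, restrict (\<gamma> \<otimes>\<^bsub>\<Gamma>\<^esub> \<gamma>') N) =
        (restrict \<gamma> M, restrict \<gamma> N) \<otimes>\<^bsub>fibre_product H D R\<^esub> (restrict \<gamma>' M, restrict \<gamma>' N)"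
        using g comp[OF stable_M[OF g(2)] MU] comp[OF stable_N[OF g(2)] N(2)]
        by (simp add: fibre_product_def Gamma_eq H_eq D_eq mult_Gal res_M res_N)
    qed
    show "bij_betw (\<lambda>\<gamma>. (restrict \<gamma> M, restrict \<gamma> N)) (carrier \<Gamma>) (carrier (fibre_product H D R))"
    proof (rule bij_betw_imageI)
      show "inj_on (\<lambda>\<gamma>. (restrict \<gamma> M, restrict \<gamma> N)) (carrier \<Gamma>)"
      proof (rule inj_onI)
        fix \<gamma> \<gamma>' assume "\<gamma> \<in> carrier \<Gamma>" "\<gamma>' \<in> carrier \<Gamma>"
          and eq: "(restrict \<gamma> M, restrict \<gamma> N) = (restrict \<gamma>' M, restrict \<gamma>' N)"
        then have g: "\<gamma> \<in> diff_aut ?I d U K" "\<gamma>' \<in> diff_aut ?I d U K" by (simp_all add: Gamma_eq)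
        have agree: "\<gamma> a = \<gamma>' a" if "a \<in> M \<or> a \<in> N" for a
          using eq that by (metis Pair_inject restrict_apply')
        have "U \<subseteq> {a \<in> U. \<gamma> a = \<gamma>' a}"
          using agree MU N(2) by (intro gen diff_subfield_equalizer[OF U g]) auto
        then show "\<gamma> = \<gamma>'"
          by (intro extensionalityI[OF diff_autD(1)[OF g(1)] diff_autD(1)[OF g(2)]]) auto
      qed
      show "(\<lambda>\<gamma>. (restrict \<gamma> M, restrict \<gamma> N)) ` carrier \<Gamma> = carrier (fibre_product H D R)"
      proof
        show "(\<lambda>\<gamma>. (restrict \<gamma> M, restrict \<gamma> N)) ` carrier \<Gamma> \<subseteq> carrier (fibre_product H D R)"
          using hom by (auto simp: hom_def)
        show "carrier (fibre_product H D R) \<subseteq> (\<lambda>\<gamma>. (restrict \<gamma> M, restrict \<gamma> N)) ` carrier \<Gamma>"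
        proof
          fix p assume "p \<in> carrier (fibre_product H D R)"
          then obtain \<sigma> \<tau> where p: "p = (\<sigma>, \<tau>)" and \<sigma>: "\<sigma> \<in> diff_aut ?I d M K"
            and \<tau>: "\<tau> \<in> diff_aut ?I d N K" and res: "restrict \<sigma> R = restrict \<tau> R"
            by (auto simp: carrier_fp)
          have agree: "\<sigma> a = \<tau> a" if "a \<in> M \<inter> N" for a
            using res that unfolding R_eq by (metis restrict_apply')
          have "\<exists>\<gamma>\<in>diff_aut ?I d U K. restrict \<gamma> M = \<sigma> \<and> restrict \<gamma> N = \<tau>"
          proof (rule diff_aut_glue[OF U M MU N(1,2) gen \<sigma> \<tau> KM])
            show "v = 0 \<longleftrightarrow> w = 0" if "paired_span \<sigma> \<tau> M N v w" for v w
              by (rule linearly_disjoint[OF U M MU K_diff_field KM o constK zeta r_in_K(1) N_eq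
                    diff_autD(3)[OF \<sigma>] diff_autD(3)[OF \<tau>] diff_autD(4)[OF \<tau> o] diff_autD(5)[OF \<tau>] agree that])
          qed
          then show "p \<in> (\<lambda>\<gamma>. (restrict \<gamma> M, restrict \<gamma> N)) ` carrier \<Gamma>"
            by (auto simp: p Gamma_eq)
        qed
      qed
    qed
  qed
qed

end
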